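(* Let $(G,\Sigma)$ be a knowledge graph with $G$ weakly connected on $n$ vertices. The algorithm KLONE, on input $(G,\Sigma)$ and $k\in\mathbb{N}$, returns a $(k,x)$-chase anonymisation of $(G,\Sigma)$ for every $x\in\{1,\dots,n\}$. Moreover, KLONE runs in $O(Mk^2n^2)$ time, under the hypotheses that the computation of the utility metric $\mathcal{U}_{\triangle}$ is $O(1)$ and that the degree distributions $p^-$ and $p^+$ have support in $\{1,\dots,n\}$.
   Context: Graphs. A (labelled weighted directed) graph is $G=(V,E,L,\omega,l)$ with vertex set $V$, $|V|=n$, edges $E\subseteq V\times V$ (self-loops allowed), label set $L$, weights $\omega:E\to[0,1]$, vertex labels $l:V\to L$; $V(G),E(G)$ denote its vertex and edge sets. $N_G^-(v)=\{u:(u,v)\in E\}$, $N_G^+(v)=\{u:(v,u)\in E\}$, $d_G^\pm(v)=|N_G^\pm(v)|$. Weakly connected means the underlying undirected graph is connected. $G[X]$ is the subgraph induced by $X\subseteq V$, with restricted weights and labels. Knowledge graphs and chase. A knowledge graph (KG) is a pair $(G,\Sigma)$ where $G=(V,E,L,\omega,l)$ is a labelled weighted directed graph, regarded as a database of facts (such as $\mathrm{company}(v)$ for vertices and $\mathrm{edge}(u,v,w)$ for edges of weight $w$), and $\Sigma$ is a finite set of Vadalog rules, i.e. existential rules $\forall \mathbf{x}\,\boldsymbol\phi(\mathbf{x})\to\exists\mathbf{z}\,\boldsymbol\psi(\mathbf{y},\mathbf{z})$, $\mathbf{y}\subseteq\mathbf{x}$, in a restriction of Datalog$^\pm$ for which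 the chase converges. The chase iteratively applies the rules, adding new facts until a fixed point $chase(G,\Sigma)$ is reached. The chase graph $\mathcal{G}(G,\Sigma)$ is the directed graph whose nodes are labelled by the facts of $chase(G,\Sigma)$ and which has an edge from $a$ to $b$ labelled $\sigma\in\Sigma$ if $b$ is obtained from $a$, and possibly other facts, by applying rule $\sigma$. The vertices of $G$ are regarded as among the nodes of the chase graph. A conjunctive query $Q$: $q(\mathbf{x})\leftarrow\boldsymbol\phi(\mathbf{x},\mathbf{y})$ is evaluated as the set $Q(G)$ of tuples $t$ of constants with $q(t)\in chase(G,\Sigma)$. Chase-isomorphism. KGs $(G,\Sigma)$, $(G',\Sigma)$ with vertex sets $V,V'$ are chase-isomorphic, $G\cong_\Sigma G'$, if: (1) $\mathcal{G}(G,\Sigma)$ and $\mathcal{G}(G',\Sigma)$ are isomorphic as directed graphs via some $\Psi$ (the chase-isomorphism); (2) $\Psi|_V$ is a bijection between $V$ and $V'$; (3) for each edge $(a,b)$ of $\mathcal{G}(G,\Sigma)$, $\sigma$ is the label of $(a,b)$ iff $\sigma$ is the label of $(\Psi(a),\Psi(b))$ in $\mathcal{G}(G',\Sigma)$. Sensitive attributes. $\xi_G(v)=\{l_G(v),d_G^-(v),d_G^+(v)\}$; by convention $\xi_G(u)\ne\xi_G(v)$ means that all three of $l_G(u)\neq l_G(v)$, $d_G^-(u)\neq d_G^-(v)$, $d_G^+(u)\neq d_G^+(v)$ hold. $(k,x)$-chase anonymisation. Let $(G,\Sigma)$ be a KG with $G=(V,E,L,\omega,l)$ weakly connected, let $x\in\{1,\dots,n\}$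 and $k\in\mathbb{N}$, $k\le\binom{n}{x}$. A $(k,x)$-chase anonymisation of $(G,\Sigma)$ is a KG $(A,\Sigma)$, $A=(V_A,E_A,L_A,\omega_A,l_A)$, such that: 1) $V\subseteq V_A$ and $E\subseteq E_A$; 2) $L\cap L_A=\emptyset$; 3) $\omega_A(e)\ne\omega(e)$ for all $e\in E$; 4) for all $X_1\subset V$ with $|X_1|=x$ and $G[X_1]$ weakly connected there exist $X_2,\dots,X_k\subseteq V_A$ such that (i) $X_i\cap X_j=\emptyset$ for all $i\ne j$ in $\{1,\dots,k\}$; (ii) $A[X_1]\cong_\Sigma A[X_i]$ through a chase-isomorphism $\Psi_i$ for all $i\in\{1,\dots,k\}$, with $\Psi_1=\mathrm{id}_{X_1}$; (iii) $\xi_A(\Psi_i(v))\ne\xi_A(\Psi_j(v))$ for all $v\in X_1$ and all $i\neq j$ in $\{1,\dots,k\}$. Utility. For a set $\mathcal{Q}$ of $N$ queries, $\mathcal{U}_{\triangle}(G,\Sigma,A,\mathcal{Q})=\frac1N\sum_{Q\in\mathcal{Q}}\frac{|Q(G)\cap Q(A)|}{|Q(G)\cup Q(A)|}$ (a term with zero denominator is $0$), constants of $G$ being identified with the corresponding ones of $A$. Subroutine WeightNoising$(A,G,\Sigma,S,\mathcal{Q},p_\omega,M)$, $S\subseteq E(A)$: for $i=1,\dots,M$ let $A_i$ be a copy of $A$ in which each $e\in S$ is given the weight $\omega_{A_i}(e)\gets z$ with $z$ drawn from $p_\omega$; return an $A_i$ maximising $\mathcal{U}_{\triangle}(G,\Sigma,A_i,\mathcal{Q})$.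 Algorithm KLONE. Input: KG $(G,\Sigma)$, $k\in\mathbb{N}$, query set $\mathcal{Q}$, in-degree distribution $p^-$, out-degree distribution $p^+$, weight distribution $p_\omega$, a label set $L_A$ with $L_A\cap L=\emptyset$, $M\in\mathbb{N}$. 1. $G\gets$ WeightNoising$(G,G,\Sigma,E,\mathcal{Q},p_\omega,M)$. 2. For $j=1,\dots,k$ let $G^j$ be a copy of $G$ with vertices $v_1^j,\dots,v_n^j$ (the vertices and edges of $G$ are identified with those of $G^1$). Let $A=\bigcup_{j=1}^k G^j$ (disjoint union), $\mathcal{A}=E(A)$, $\mathcal{V}=\emptyset$. Add to $A$ one random edge between $G^j$ and $G^{j+1}$ for each $j=1,\dots,k-1$. 3. For $i=1,\dots,n$: set $\delta_1^-=d_A^-(v_i^1)$, $\delta_1^+=d_A^+(v_i^1)$, add $v_i^1$ to $\mathcal{V}$; then for $j=2,\dots,k$: for each $\varphi\in\{-,+\}$ do (a)–(d), and afterwards add $v_i^j$ to $\mathcal{V}$: (a) $\delta_j^\varphi\gets d_A^\varphi(v_i^j)$; while $\delta_j^\varphi\in\{\delta_1^\varphi,\dots,\delta_{j-1}^\varphi\}$, set $\delta_j^\varphi\gets\max\{\delta_j^\varphi+1,z\}$ with $z$ drawn from $p^\varphi$. (b) $\Delta\gets\delta_j^\varphi-d_A^\varphi(v_i^j)$ and $\mathcal{C}\gets\{v\in V(A): v\notin N_A^\varphi(v_i^j)\cup\mathcal{V}\cup V(G^j)\}$. (c) If $|\mathcal{C}|<\Delta$, add $\Delta-|\mathcal{C}|$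 new vertices to $V(A)$ and to $\mathcal{C}$. (d) Select $\Delta$ elements $c_1,\dots,c_\Delta$ of $\mathcal{C}$; add to $E(A)$ the edges $(c_t,v_i^j)$ if $\varphi=-$, or $(v_i^j,c_t)$ if $\varphi=+$, $t=1,\dots,\Delta$. 4. $S\gets E(A)\setminus\mathcal{A}$; assign to each $v\in V(A)$ a different label of $L_A$; $A\gets$ WeightNoising$(A,G,\Sigma,S,\mathcal{Q},p_\omega,M)$. Output $(A,\Sigma)$.
   Formalization: Added: p_ω gives probability 0 to every weight occurring in G (otherwise ω_A(e)≠ω(e) can fail), and claims hold almost surely over the draws; L_A is assumed to have enough labels, k,M≥1, and constants in rules, if any, are neither vertices nor labels of L_A. *)

theory Defs
  imports
    "HOL-Probability.Probability"
    "HOL-Library.While_Combinator"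
    "HOL-Library.Monad_Syntax"
begin

section \<open>Graphs\<close>

text \<open>Only the values of \<open>weight\<close> on \<open>edges\<close> and of \<open>label\<close> on \<open>verts\<close> are meaningful.\<close>

record ('v, 'l) graph =
  verts :: "'v set"
  edges :: "('v \<times> 'v) set"
  labels :: "'l set"
  weight :: "'v \<times> 'v \<Rightarrow> real"
  label :: "'v \<Rightarrow> 'l"

definition wf_graph :: "('v, 'l) graph \<Rightarrow> bool" where
  "wf_graph G \<longleftrightarrow> finite (verts G) \<and> edges G \<subseteq> verts G \<times> verts G \<and>
     (\<forall>e\<in>edges G. weight G e \<in> {0..1}) \<and> (\<forall>v\<in>verts G. label G v \<in> labels G)"

datatype dir = In | Out

fun nbrs :: "dir \<Rightarrow> ('v, 'l) graph \<Rightarrow> 'v \<Rightarrow> 'v set" where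
  "nbrs In G v = {u. (u, v) \<in> edges G}"
| "nbrs Out G v = {u. (v, u) \<in> edges G}"

definition deg :: "dir \<Rightarrow> ('v, 'l) graph \<Rightarrow> 'v \<Rightarrow> nat" where
  "deg d G v = card (nbrs d G v)"

definition induced :: "('v, 'l) graph \<Rightarrow> 'v set \<Rightarrow> ('v, 'l) graph" where
  "induced G X = G\<lparr>verts := verts G \<inter> X, edges := edges G \<inter> X \<times> X\<rparr>"

definition weakly_connected :: "('v, 'l) graph \<Rightarrow> bool" where
  "weakly_connected G \<longleftrightarrow> verts G \<noteq> {} \<and>
     (\<forall>u\<in>verts G. \<forall>v\<in>verts G. (u, v) \<in> (edges G \<union> (edges G)\<inverse>)\<^sup>*)"


section \<open>Existential rules and the chase\<close>

datatype ('v, 'l) const = VertexC 'v | WeightC real | LabelC 'l | DataC string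

datatype pred = VertexP | EdgeP | LabelP | UserP string

datatype 'c trm = Var nat | Cst 'c

datatype 'c atom = Atom pred "'c trm list"

datatype 'c rule = Rule (body: "'c atom list") (head: "'c atom list")

text \<open>
  Chase values. Each application of a rule \<open>\<sigma>\<close> invents its own labelled nulls (oblivious chase):
  \<open>Null \<sigma> z as\<close> is the null invented for the existential variable \<open>z\<close> when \<open>\<sigma>\<close> is applied with
  its body variables bound to \<open>as\<close>. Naming the nulls this way makes the result of the chase
  independent of the order of rule applications.
\<close>

datatype 'c val = Val 'c | Null "'c rule" nat "'c val list"

datatype 'c fact = Fact pred "'c val list"

fun trm_vars :: "'c trm \<Rightarrow> nat list" where
  "trm_vars (Var x) = [x]"
| "trm_vars (Cst c) = []"

fun atom_vars :: "'c atom \<Rightarrow> nat list" where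
  "atom_vars (Atom p ts) = concat (map trm_vars ts)"

definition body_vars :: "'c rule \<Rightarrow> nat list" where
  "body_vars \<sigma> = concat (map atom_vars (body \<sigma>))"

definition rule_consts :: "'c rule \<Rightarrow> 'c set" where
  "rule_consts \<sigma> = set_rule \<sigma>"

fun inst_trm :: "(nat \<Rightarrow> 'c val) \<Rightarrow> 'c trm \<Rightarrow> 'c val" where
  "inst_trm h (Var x) = h x"
| "inst_trm h (Cst c) = Val c"

fun inst :: "(nat \<Rightarrow> 'c val) \<Rightarrow> 'c atom \<Rightarrow> 'c fact" where
  "inst h (Atom p ts) = Fact p (map (inst_trm h) ts)"

text \<open>The existential variables of a rule are the head variables that do not occur in the body.\<close>

definition extend :: "'c rule \<Rightarrow> (nat \<Rightarrow> 'c val) \<Rightarrow> nat \<Rightarrow> 'c val" where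
  "extend \<sigma> h x = (if x \<in> set (body_vars \<sigma>) then h x else Null \<sigma> x (map h (body_vars \<sigma>)))"

definition trigger :: "'c fact set \<Rightarrow> 'c rule \<Rightarrow> (nat \<Rightarrow> 'c val) \<Rightarrow> bool" where
  "trigger I \<sigma> h \<longleftrightarrow> inst h ` set (body \<sigma>) \<subseteq> I"

definition chase_step :: "'c rule set \<Rightarrow> 'c fact set \<Rightarrow> 'c fact set" where
  "chase_step \<Sigma> I = I \<union> (\<Union>\<sigma>\<in>\<Sigma>. \<Union>h\<in>{h. trigger I \<sigma> h}. inst (extend \<sigma> h) ` set (head \<sigma>))"

definition chase :: "'c fact set \<Rightarrow> 'c rule set \<Rightarrow> 'c fact set" where
  "chase D \<Sigma> = (\<Union>i. (chase_step \<Sigma> ^^ i) D)"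

definition chase_converges :: "'c fact set \<Rightarrow> 'c rule set \<Rightarrow> bool" where
  "chase_converges D \<Sigma> \<longleftrightarrow> (\<exists>i. (chase_step \<Sigma> ^^ Suc i) D = (chase_step \<Sigma> ^^ i) D)"

type_synonym ('v, 'l) gfact = "('v, 'l) const fact"
type_synonym ('v, 'l) grule = "('v, 'l) const rule"

definition vertex_fact :: "'v \<Rightarrow> ('v, 'l) gfact" where
  "vertex_fact v = Fact VertexP [Val (VertexC v)]"

definition graph_facts :: "('v, 'l) graph \<Rightarrow> ('v, 'l) gfact set" where
  "graph_facts G =
     vertex_fact ` verts G \<union>
     {Fact EdgeP [Val (VertexC u), Val (VertexC v), Val (WeightC (weight G (u, v)))] |
        u v. (u, v) \<in> edges G} \<union>
     {Fact LabelP [Val (VertexC v), Val (LabelC (label G v))] | v. v \<in> verts G}"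

text \<open>
  The restriction imposed on the rule language is that the chase of every graph converges.
\<close>

definition knowledge_graph :: "('v, 'l) graph \<Rightarrow> ('v, 'l) grule set \<Rightarrow> bool" where
  "knowledge_graph G \<Sigma> \<longleftrightarrow> wf_graph G \<and> finite \<Sigma> \<and>
     (\<forall>H :: ('v, 'l) graph. wf_graph H \<longrightarrow> chase_converges (graph_facts H) \<Sigma>)"

definition chase_nodes :: "('v, 'l) graph \<Rightarrow> ('v, 'l) grule set \<Rightarrow> ('v, 'l) gfact set" where
  "chase_nodes G \<Sigma> = chase (graph_facts G) \<Sigma>"

definition chase_arcs ::
  "('v, 'l) graph \<Rightarrow> ('v, 'l) grule set \<Rightarrow> (('v, 'l) gfact \<times> ('v, 'l) grule \<times> ('v, 'l) gfact) set"
where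
  "chase_arcs G \<Sigma> = {(a, \<sigma>, b). \<sigma> \<in> \<Sigma> \<and>
     (\<exists>h. trigger (chase_nodes G \<Sigma>) \<sigma> h \<and> a \<in> inst h ` set (body \<sigma>) \<and>
          b \<in> inst (extend \<sigma> h) ` set (head \<sigma>))}"

text \<open>
  A vertex \<open>v\<close> is the node \<open>vertex_fact v\<close> of the chase graph. An edge may carry several labels,
  one for each rule deriving its target from its source.
\<close>

definition chase_isomorphism ::
  "('v, 'l) grule set \<Rightarrow> ('v, 'l) graph \<Rightarrow> ('v, 'l) graph \<Rightarrow>
   (('v, 'l) gfact \<Rightarrow> ('v, 'l) gfact) \<Rightarrow> bool"
where
  "chase_isomorphism \<Sigma> G H \<Psi> \<longleftrightarrow>
     bij_betw \<Psi> (chase_nodes G \<Sigma>) (chase_nodes H \<Sigma>) \<and>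
     (\<forall>a\<in>chase_nodes G \<Sigma>. \<forall>b\<in>chase_nodes G \<Sigma>.
        (\<exists>\<sigma>. (a, \<sigma>, b) \<in> chase_arcs G \<Sigma>) \<longleftrightarrow> (\<exists>\<sigma>. (\<Psi> a, \<sigma>, \<Psi> b) \<in> chase_arcs H \<Sigma>)) \<and>
     bij_betw \<Psi> (vertex_fact ` verts G) (vertex_fact ` verts H) \<and>
     (\<forall>a b. (\<exists>\<sigma>. (a, \<sigma>, b) \<in> chase_arcs G \<Sigma>) \<longrightarrow>
        (\<forall>\<sigma>. (a, \<sigma>, b) \<in> chase_arcs G \<Sigma> \<longleftrightarrow> (\<Psi> a, \<sigma>, \<Psi> b) \<in> chase_arcs H \<Sigma>))"

definition on_verts :: "(('v, 'l) gfact \<Rightarrow> ('v, 'l) gfact) \<Rightarrow> 'v \<Rightarrow> 'v" where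
  "on_verts \<Psi> v = (THE w. \<Psi> (vertex_fact v) = vertex_fact w)"


section \<open>Chase anonymisations\<close>

text \<open>The convention for \<open>\<xi>\<^sub>G(u) \<noteq> \<xi>\<^sub>G(v)\<close>: all three sensitive attributes differ.\<close>

definition attrs_differ :: "('v, 'l) graph \<Rightarrow> 'v \<Rightarrow> 'v \<Rightarrow> bool" where
  "attrs_differ G u v \<longleftrightarrow> label G u \<noteq> label G v \<and> deg In G u \<noteq> deg In G v \<and> deg Out G u \<noteq> deg Out G v"

text \<open>
  The parameter range \<open>k \<le> n choose x\<close> is not a condition on \<open>A\<close>; the definition makes sense
  for all \<open>k\<close>.
\<close>

definition chase_anonymisation ::
  "nat \<Rightarrow> nat \<Rightarrow> ('v, 'l) graph \<Rightarrow> ('v, 'l) grule set \<Rightarrow> ('v, 'l) graph \<Rightarrow> bool"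
where
  "chase_anonymisation k x G \<Sigma> A \<longleftrightarrow>
     knowledge_graph A \<Sigma> \<and>
     verts G \<subseteq> verts A \<and> edges G \<subseteq> edges A \<and>
     labels G \<inter> labels A = {} \<and>
     (\<forall>e\<in>edges G. weight A e \<noteq> weight G e) \<and>
     (\<forall>X1 \<subseteq> verts G. card X1 = x \<and> weakly_connected (induced G X1) \<longrightarrow>
        (\<exists>X \<Psi>. X 1 = X1 \<and> (\<forall>i\<in>{1..k}. X i \<subseteq> verts A) \<and>
           (\<forall>i\<in>{1..k}. \<forall>j\<in>{1..k}. i \<noteq> j \<longrightarrow> X i \<inter> X j = {}) \<and>
           (\<forall>i\<in>{1..k}. chase_isomorphism \<Sigma> (induced A X1) (induced A (X i)) (\<Psi> i)) \<and>
           (\<forall>v\<in>X1. on_verts (\<Psi> 1) v = v) \<and>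
           (\<forall>v\<in>X1. \<forall>i\<in>{1..k}. \<forall>j\<in>{1..k}. i \<noteq> j \<longrightarrow>
              attrs_differ A (on_verts (\<Psi> i) v) (on_verts (\<Psi> j) v))))"


section \<open>Queries and utility\<close>

text \<open>\<open>Query xs \<phi>\<close> is the conjunctive query with answer variables \<open>xs\<close> and body \<open>\<phi>\<close>.\<close>

datatype 'c query = Query "nat list" "'c atom list"

fun answers ::
  "('v, 'l) const query \<Rightarrow> ('v, 'l) graph \<Rightarrow> ('v, 'l) grule set \<Rightarrow> ('v, 'l) const list set"
where
  "answers (Query xs \<phi>) G \<Sigma> =
     {t. \<exists>h. inst h ` set \<phi> \<subseteq> chase (graph_facts G) \<Sigma> \<and> map h xs = map Val t}"

definition utility ::
  "('v, 'l) graph \<Rightarrow> ('v, 'l) grule set \<Rightarrow> ('v, 'l) const query set \<Rightarrow> ('v, 'l) graph \<Rightarrow> real"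
where
  "utility G \<Sigma> Qs A =
     (\<Sum>Q\<in>Qs. real (card (answers Q G \<Sigma> \<inter> answers Q A \<Sigma>)) /
              real (card (answers Q G \<Sigma> \<union> answers Q A \<Sigma>))) / real (card Qs)"


section \<open>The algorithm KLONE\<close>

text \<open>
  Every random draw from \<open>p\<^sub>\<omega>\<close>, \<open>p\<^sup>-\<close>, \<open>p\<^sup>+\<close> is a separate independent random
  variable, indexed by its position in the program: the first component of a sample holds the
  weight drawn in step \<open>p\<close> (1 or 4) of the algorithm for the edge \<open>e\<close> of the \<open>i\<close>-th copy
  at \<open>(p, i, e)\<close>; the second component holds the degree drawn in the \<open>t\<close>-th iteration
  of the while loop for direction \<open>d\<close> and vertex \<open>v\<^sub>i\<^sup>j\<close> at \<open>(d, i, j, t)\<close>.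
\<close>

type_synonym 'v sample =
  "(nat \<times> nat \<times> 'v \<times> 'v \<Rightarrow> real) \<times> (dir \<times> nat \<times> nat \<times> nat \<Rightarrow> nat)"

definition klone_space :: "real measure \<Rightarrow> (dir \<Rightarrow> nat pmf) \<Rightarrow> 'v sample measure" where
  "klone_space p\<omega> p = (\<Pi>\<^sub>M _\<in>UNIV. p\<omega>) \<Otimes>\<^sub>M (\<Pi>\<^sub>M q\<in>UNIV. measure_pmf (p (fst q)))"

text \<open>
  Everything that the algorithm leaves open is resolved by a record of choices, over all valid
  values of which the results quantify: the order \<open>v\<^sub>1, \<dots>, v\<^sub>n\<close> of the vertices,
  the name \<open>copy j v\<close> of the copy of \<open>v\<close> in \<open>G\<^sup>j\<close>, the names of the vertices added in
  step 3(c), the edges linking \<open>G\<^sup>j\<close> to \<open>G\<^bsup>j+1\<^esup>\<close>, the vertices selected in step 3(d),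
  the new labels, and the choice among several maximisers in either call of the weight noising
  subroutine. As every selection is made at a distinct index, \<open>select\<close> can realise all
  possible histories of selections, and in particular any random selection.
\<close>

record ('v, 'l) choices =
  vertex_list :: "'v list"
  copy :: "nat \<Rightarrow> 'v \<Rightarrow> 'v"
  new_vertex :: "nat \<Rightarrow> 'v"
  link :: "nat \<Rightarrow> 'v \<times> 'v"
  select :: "dir \<Rightarrow> nat \<Rightarrow> nat \<Rightarrow> 'v set \<Rightarrow> nat \<Rightarrow> 'v set"
  relabel :: "'v set \<Rightarrow> 'v \<Rightarrow> 'l"
  best :: "nat \<Rightarrow> real list \<Rightarrow> nat"

definition labels_suffice :: "'l set \<Rightarrow> 'v set \<Rightarrow> bool" where
  "labels_suffice LA W \<longleftrightarrow> infinite LA \<or> card W \<le> card LA"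

definition valid_choices ::
  "('v, 'l) graph \<Rightarrow> nat \<Rightarrow> 'l set \<Rightarrow> ('v, 'l) choices \<Rightarrow> bool"
where
  "valid_choices G k LA ch \<longleftrightarrow>
     distinct (vertex_list ch) \<and> set (vertex_list ch) = verts G \<and>
     (\<forall>v\<in>verts G. copy ch 1 v = v) \<and>
     inj_on (\<lambda>(j, v). copy ch j v) ({1..k} \<times> verts G) \<and>
     inj (new_vertex ch) \<and>
     (\<forall>m. \<forall>j\<in>{1..k}. new_vertex ch m \<notin> copy ch j ` verts G) \<and>
     (\<forall>j\<in>{1..<k}. link ch j \<in>
        copy ch j ` verts G \<times> copy ch (j + 1) ` verts G \<union>
        copy ch (j + 1) ` verts G \<times> copy ch j ` verts G) \<and>
     (\<forall>d i j C \<Delta>. finite C \<and> \<Delta> \<le> card C \<longrightarrow>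
        select ch d i j C \<Delta> \<subseteq> C \<and> card (select ch d i j C \<Delta>) = \<Delta>) \<and>
     (\<forall>W. finite W \<and> labels_suffice LA W \<longrightarrow>
        inj_on (relabel ch W) W \<and> relabel ch W ` W \<subseteq> LA) \<and>
     (\<forall>p us. us \<noteq> [] \<longrightarrow> best ch p us < length us \<and> (\<forall>u\<in>set us. u \<le> us ! best ch p us))"

text \<open>
  Running time is counted on a unit-cost machine. Graphs are stored as adjacency matrices, so
  building a graph on \<open>m\<close> vertices or scanning all its edges costs \<open>m\<^sup>2\<close>, computing a
  degree or the set \<open>\<C>\<close> costs \<open>m\<close>, and adding a vertex costs one row and one column. Sets of
  vertices and of numbers are stored as characteristic arrays, so a membership test or an
  insertion costs 1, and so do a random draw and an arithmetic operation. Evaluating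
  \<open>utility G \<Sigma> Qs A\<close> costs \<open>tU G A\<close>. The functions below return the time spent together with
  the result.
\<close>

definition reweight :: "('v, 'l) graph \<Rightarrow> ('v \<times> 'v) set \<Rightarrow> ('v \<times> 'v \<Rightarrow> real) \<Rightarrow> ('v, 'l) graph" where
  "reweight A S z = A\<lparr>weight := (\<lambda>e. if e \<in> S then z e else weight A e)\<rparr>"

text \<open>Per copy: copying, one draw and one assignment per edge of \<open>S\<close>, the utility, a comparison.\<close>

definition weight_noising ::
  "('v, 'l) graph \<Rightarrow> ('v, 'l) graph \<Rightarrow> ('v, 'l) grule set \<Rightarrow> ('v \<times> 'v) set \<Rightarrow>
   ('v, 'l) const query set \<Rightarrow> nat \<Rightarrow> (('v, 'l) graph \<Rightarrow> ('v, 'l) graph \<Rightarrow> nat) \<Rightarrow>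
   (real list \<Rightarrow> nat) \<Rightarrow> (nat \<Rightarrow> 'v \<times> 'v \<Rightarrow> real) \<Rightarrow> ('v, 'l) graph \<times> nat"
where
  "weight_noising A G \<Sigma> S Qs M tU pick z =
     (let As = map (\<lambda>i. reweight A S (z i)) [1..<M + 1]
      in (As ! pick (map (utility G \<Sigma> Qs) As),
          \<Sum>B\<leftarrow>As. (card (verts B))\<^sup>2 + 2 * card S + tU G B + 1))"

definition disjoint_copies :: "nat \<Rightarrow> (nat \<Rightarrow> 'v \<Rightarrow> 'v) \<Rightarrow> ('v, 'l) graph \<Rightarrow> ('v, 'l) graph" where
  "disjoint_copies k cp G =
     (let orig = (\<lambda>u. THE v. v \<in> verts G \<and> (\<exists>j\<in>{1..k}. cp j v = u))
      in \<lparr>verts = (\<Union>j\<in>{1..k}. cp j ` verts G),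
          edges = (\<Union>j\<in>{1..k}. map_prod (cp j) (cp j) ` edges G),
          labels = labels G,
          weight = (\<lambda>(u, v). weight G (orig u, orig v)),
          label = (\<lambda>u. label G (orig u))\<rparr>)"

text \<open>
  The state of step 3: \<open>seen\<close> is \<open>\<V>\<close>, \<open>deltas d\<close> lists the numbers
  \<open>\<delta>\<^sub>1, \<delta>\<^sub>2, \<dots>\<close> of the current vertex for direction \<open>d\<close>, \<open>news\<close> counts the
  vertices added so far, and \<open>clock\<close> is the time spent so far.
\<close>

record ('v, 'l) state =
  cur :: "('v, 'l) graph"
  seen :: "'v set"
  deltas :: "dir \<Rightarrow> nat list"
  news :: nat
  clock :: nat

text \<open>
  The while loop of step 3(a), also counting its iterations; the result is \<open>None\<close> if it does
  not terminate.
\<close>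

definition find_delta :: "nat set \<Rightarrow> (nat \<Rightarrow> nat) \<Rightarrow> nat \<Rightarrow> (nat \<times> nat) option" where
  "find_delta used z \<delta>0 =
     while_option (\<lambda>(\<delta>, t). \<delta> \<in> used) (\<lambda>(\<delta>, t). (max (\<delta> + 1) (z t), t + 1)) (\<delta>0, 0)"

text \<open>
  Steps 3(a) to 3(d) for the vertex \<open>v\<^sub>i\<^sup>j\<close> and the direction \<open>d\<close>. The truncated
  difference \<open>\<Delta> - card C\<close> is 0 if there are enough candidates.
\<close>

definition adjust_degree ::
  "('v, 'l) graph \<Rightarrow> ('v, 'l) choices \<Rightarrow> (dir \<times> nat \<times> nat \<times> nat \<Rightarrow> nat) \<Rightarrow>
   nat \<Rightarrow> nat \<Rightarrow> dir \<Rightarrow> ('v, 'l) state \<Rightarrow> ('v, 'l) state option"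
where
  "adjust_degree G ch z i j d st =
     (let A = cur st; v = copy ch j (vertex_list ch ! (i - 1)) in
      do {
        (\<delta>, t) \<leftarrow> find_delta (set (deltas st d)) (\<lambda>t. z (d, i, j, t)) (deg d A v);
        let \<Delta> = \<delta> - deg d A v;
        let C = {u \<in> verts A. u \<notin> nbrs d A v \<union> seen st \<union> copy ch j ` verts G};
        let m = \<Delta> - card C;
        let N = new_vertex ch ` {news st ..< news st + m};
        let T = select ch d i j (C \<union> N) \<Delta>;
        let A' = A\<lparr>verts := verts A \<union> N,
                   edges := edges A \<union> (case d of In \<Rightarrow> T \<times> {v} | Out \<Rightarrow> {v} \<times> T)\<rparr>;
        Some (st\<lparr>cur := A', deltas := (deltas st)(d := deltas st d @ [\<delta>]), news := news st + m,
          clock := clock st + card (verts A) + (3 * t + 1) + 1 + card (verts A)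
                   + m * (2 * card (verts A')) + card (C \<union> N) + \<Delta>\<rparr>)
      })"

definition process_copy ::
  "('v, 'l) graph \<Rightarrow> ('v, 'l) choices \<Rightarrow> (dir \<times> nat \<times> nat \<times> nat \<Rightarrow> nat) \<Rightarrow>
   nat \<Rightarrow> nat \<Rightarrow> ('v, 'l) state \<Rightarrow> ('v, 'l) state option"
where
  "process_copy G ch z i j st =
     do {
       st \<leftarrow> adjust_degree G ch z i j In st;
       st \<leftarrow> adjust_degree G ch z i j Out st;
       Some (st\<lparr>seen := insert (copy ch j (vertex_list ch ! (i - 1))) (seen st), clock := clock st + 1\<rparr>)
     }"

fun iterate :: "('a \<Rightarrow> 's \<Rightarrow> 's option) \<Rightarrow> 'a list \<Rightarrow> 's \<Rightarrow> 's option" where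
  "iterate f [] s = Some s"
| "iterate f (x # xs) s = do { s \<leftarrow> f x s; iterate f xs s }"

text \<open>The summand \<open>2 * k\<close> pays for emptying the two arrays of used degrees.\<close>

definition process_vertex ::
  "('v, 'l) graph \<Rightarrow> nat \<Rightarrow> ('v, 'l) choices \<Rightarrow> (dir \<times> nat \<times> nat \<times> nat \<Rightarrow> nat) \<Rightarrow>
   nat \<Rightarrow> ('v, 'l) state \<Rightarrow> ('v, 'l) state option"
where
  "process_vertex G k ch z i st =
     (let v = copy ch 1 (vertex_list ch ! (i - 1))
      in iterate (process_copy G ch z i) [2..<k + 1]
           (st\<lparr>deltas := (\<lambda>d. [deg d (cur st) v]), seen := insert v (seen st),
              clock := clock st + 2 * card (verts (cur st)) + 2 * k + 1\<rparr>))"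

text \<open>
  The summands of \<open>clock\<close> are: weight noising; building the disjoint union and its \<open>k - 1\<close>
  links; step 3; scanning for \<open>S\<close>, relabelling, and weight noising. As in the algorithm, step 4
  measures utility against the graph obtained in step 1.
\<close>

definition klone ::
  "('v, 'l) graph \<Rightarrow> ('v, 'l) grule set \<Rightarrow> nat \<Rightarrow> ('v, 'l) const query set \<Rightarrow> 'l set \<Rightarrow> nat \<Rightarrow>
   (('v, 'l) graph \<Rightarrow> ('v, 'l) graph \<Rightarrow> nat) \<Rightarrow> ('v, 'l) choices \<Rightarrow> 'v sample \<Rightarrow>
   (('v, 'l) graph \<times> nat) option"
where
  "klone G \<Sigma> k Qs LA M tU ch s =
     (let n = card (verts G);
          (G', t1) = weight_noising G G \<Sigma> (edges G) Qs M tU (best ch 1) (\<lambda>i e. fst s (1, i, e));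
          A0 = disjoint_copies k (copy ch) G'
      in do {
        st \<leftarrow> iterate (process_vertex G' k ch (snd s)) [1..<n + 1]
          \<lparr>cur = A0\<lparr>edges := edges A0 \<union> link ch ` {1..<k}\<rparr>, seen = {}, deltas = (\<lambda>_. []), news = 0,
           clock = t1 + (card (verts A0))\<^sup>2 + (k - 1)\<rparr>;
        let B = cur st;
        let S = edges B - edges A0;
        let B' = B\<lparr>labels := LA, label := relabel ch (verts B)\<rparr>;
        let (A, t4) = weight_noising B' G' \<Sigma> S Qs M tU (best ch 4) (\<lambda>i e. fst s (4, i, e));
        Some (A, clock st + (card (verts B))\<^sup>2 + card (verts B) + t4)
      })"


section \<open>Admissible inputs\<close>

text \<open>
  The conditions on \<open>\<Sigma>\<close> and \<open>p\<omega>\<close> cannot be dropped. A rule naming an individual vertex or a new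
  label as a constant tells the copies of a subgraph apart (rules without constants satisfy the
  condition), and a weight that \<open>p\<omega>\<close> draws with positive probability may be drawn for an edge
  that already has it (a \<open>p\<omega>\<close> without atoms satisfies the condition).
\<close>

definition klone_input ::
  "('v, 'l) graph \<Rightarrow> ('v, 'l) grule set \<Rightarrow> nat \<Rightarrow> ('v, 'l) const query set \<Rightarrow> 'l set \<Rightarrow> nat \<Rightarrow>
   real measure \<Rightarrow> bool"
where
  "klone_input G \<Sigma> k Qs LA M p\<omega> \<longleftrightarrow>
     knowledge_graph G \<Sigma> \<and> weakly_connected G \<and>
     1 \<le> k \<and> 1 \<le> M \<and> finite Qs \<and> LA \<inter> labels G = {} \<and>
     (\<forall>\<sigma>\<in>\<Sigma>. rule_consts \<sigma> \<inter> (range VertexC \<union> LabelC ` LA) = {}) \<and>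
     prob_space p\<omega> \<and> sets p\<omega> = sets (restrict_space borel {0..1}) \<and>
     (\<forall>e\<in>edges G. measure p\<omega> {weight G e} = 0)"

end

theory Submission
  imports Defs
begin

text \<open>
  Since the rules mention neither vertices nor new labels, the chase commutes with every
  permutation of the constants that fixes the constants of the rules. No edge added in step 2 or 3
  has both ends in one copy \<open>G\<^sup>j\<close>, and all labels of \<open>A\<close> are distinct, so the copies of an
  induced subgraph differ by such a permutation, which is a chase-isomorphism. Steps 3(a) to (d) make
  the degrees of the copies of a vertex distinct, and the degrees of the vertices in \<open>\<V>\<close> no longer
  change. For the weights it suffices that, almost surely, none of the finitely many draws of step 1
  hits the weight of its edge.

  For the running time, a vertex created in step 3(c) is always a candidate in step 3(b), so after
  vertices have been created their total number is at most the current \<open>\<Delta>\<close>. The degree of a copy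
  that is not yet processed is at most \<open>kn\<close>, as none of its neighbours was created in step 3(c), and
  the while loop passes at most \<open>k\<close> used degrees; hence \<open>\<Delta> \<le> 2kn\<close>. So \<open>A\<close> never has more than
  \<open>3kn\<close> vertices.
\<close>

text \<open>The functions \<open>extend\<close> of the record types shadow the function \<open>extend\<close> of the chase.\<close>

hide_const (open) state.extend choices.extend graph.extend
hide_fact (open) state.extend_def choices.extend_def graph.extend_def

section \<open>Renaming the constants of a chase\<close>

text \<open>A null keeps its rule unrenamed: the renamings applied to a chase below fix the
  constants of its rules, so only the values bound to the body variables have to change.\<close>

primrec rename_val :: "('c \<Rightarrow> 'c) \<Rightarrow> 'c val \<Rightarrow> 'c val" where
  "rename_val \<pi> (Val c) = Val (\<pi> c)"
| "rename_val \<pi> (Null \<sigma> x vs) = Null \<sigma> x (map (rename_val \<pi>) vs)"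

fun rename_fact :: "('c \<Rightarrow> 'c) \<Rightarrow> 'c fact \<Rightarrow> 'c fact" where
  "rename_fact \<pi> (Fact p vs) = Fact p (map (rename_val \<pi>) vs)"

lemma rename_val_rename_val: "rename_val \<pi> (rename_val \<rho> v) = rename_val (\<pi> \<circ> \<rho>) v"
  by (induction v) auto

lemma rename_val_id: "rename_val id v = v"
  by (induction v) (auto simp: map_idI)

lemma rename_fact_rename_fact: "rename_fact \<pi> (rename_fact \<rho> a) = rename_fact (\<pi> \<circ> \<rho>) a"
  by (cases a) (auto simp: rename_val_rename_val)

lemma rename_fact_id: "rename_fact id a = a"
  by (cases a) (auto simp: rename_val_id map_idI)

lemma bij_rename_val: "bij \<pi> \<Longrightarrow> bij (rename_val \<pi>)"
  by (rule o_bij[where g = "rename_val (inv \<pi>)"])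
     (auto simp: fun_eq_iff rename_val_rename_val rename_val_id bij_is_inj surj_iff[THEN iffD1] bij_is_surj)

lemma bij_rename_fact: "bij \<pi> \<Longrightarrow> bij (rename_fact \<pi>)"
  by (rule o_bij[where g = "rename_fact (inv \<pi>)"])
     (auto simp: fun_eq_iff rename_fact_rename_fact rename_fact_id bij_is_inj surj_iff[THEN iffD1] bij_is_surj)

lemma inst_rename:
  assumes "\<And>c. c \<in> set_atom a \<Longrightarrow> \<pi> c = c"
  shows "inst (rename_val \<pi> \<circ> h) a = rename_fact \<pi> (inst h a)"
proof (cases a)
  case (Atom p ts)
  have "inst_trm (rename_val \<pi> \<circ> h) t = rename_val \<pi> (inst_trm h t)" if "t \<in> set ts" for t
  proof (cases t)
    case (Cst c)
    then have "c \<in> set_atom a" using that Atom by (auto intro!: bexI[of _ t])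
    then show ?thesis using Cst assms by simp
  qed simp
  then show ?thesis using Atom by auto
qed

text \<open>A null is named by its rule, variable and body bindings, so renaming the bindings
  already renames the null; no fresh names have to be matched up.\<close>

lemma extend_rename: "extend \<sigma> (rename_val \<pi> \<circ> h) = rename_val \<pi> \<circ> extend \<sigma> h"
  by (auto simp: extend_def fun_eq_iff)

text \<open>Change of variables in the quantifier over assignments: composition with a bijective
  renaming is onto.\<close>

lemma ex_assignment_rename:
  assumes "bij \<pi>"
  shows "(\<exists>h. P h) \<longleftrightarrow> (\<exists>h. P (rename_val \<pi> \<circ> h))"
proof
  assume "\<exists>h. P h"
  then obtain h where h: "P h" ..
  have "h = rename_val \<pi> \<circ> (inv (rename_val \<pi>) \<circ> h)"
    using bij_rename_val[OF assms] by (simp add: fun_eq_iff bij_is_surj surj_f_inv_f)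
  then show "\<exists>h. P (rename_val \<pi> \<circ> h)" using h by metis
qed auto

context
  fixes \<Sigma> :: "'c rule set" and \<pi> :: "'c \<Rightarrow> 'c"
  assumes bij: "bij \<pi>" and fixed: "\<And>\<sigma> c. \<sigma> \<in> \<Sigma> \<Longrightarrow> c \<in> rule_consts \<sigma> \<Longrightarrow> \<pi> c = c"
begin

lemma inst_image_body:
  assumes "\<sigma> \<in> \<Sigma>"
  shows "inst (rename_val \<pi> \<circ> h) ` set (body \<sigma>) = rename_fact \<pi> ` inst h ` set (body \<sigma>)"
  unfolding image_image
  by (rule image_cong[OF refl], rule inst_rename)
    (use fixed[OF assms] in \<open>auto simp: rule_consts_def rule.set_sel\<close>)

lemma inst_image_head:
  assumes "\<sigma> \<in> \<Sigma>"
  shows "inst (extend \<sigma> (rename_val \<pi> \<circ> h)) ` set (head \<sigma>) =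
    rename_fact \<pi> ` inst (extend \<sigma> h) ` set (head \<sigma>)"
  unfolding image_image extend_rename
  by (rule image_cong[OF refl], rule inst_rename)
    (use fixed[OF assms] in \<open>auto simp: rule_consts_def rule.set_sel\<close>)

lemma inj_rename_fact: "inj (rename_fact \<pi>)"
  using bij_rename_fact[OF bij] by (rule bij_is_inj)

lemma trigger_rename:
  assumes "\<sigma> \<in> \<Sigma>"
  shows "trigger (rename_fact \<pi> ` I) \<sigma> (rename_val \<pi> \<circ> h) \<longleftrightarrow> trigger I \<sigma> h"
  unfolding trigger_def inst_image_body[OF assms]
  by (rule inj_image_subset_iff[OF inj_rename_fact])

lemma chase_step_rename: "chase_step \<Sigma> (rename_fact \<pi> ` I) = rename_fact \<pi> ` chase_step \<Sigma> I"
proof -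
  have "(\<Union>h\<in>{h. trigger (rename_fact \<pi> ` I) \<sigma> h}. inst (extend \<sigma> h) ` set (head \<sigma>)) =
    rename_fact \<pi> ` (\<Union>h\<in>{h. trigger I \<sigma> h}. inst (extend \<sigma> h) ` set (head \<sigma>))"
    if "\<sigma> \<in> \<Sigma>" for \<sigma>
  proof -
    have "b \<in> (\<Union>h\<in>{h. trigger (rename_fact \<pi> ` I) \<sigma> h}. inst (extend \<sigma> h) ` set (head \<sigma>)) \<longleftrightarrow>
      b \<in> rename_fact \<pi> ` (\<Union>h\<in>{h. trigger I \<sigma> h}. inst (extend \<sigma> h) ` set (head \<sigma>))" for b
    proof -
      have "b \<in> (\<Union>h\<in>{h. trigger (rename_fact \<pi> ` I) \<sigma> h}. inst (extend \<sigma> h) ` set (head \<sigma>)) \<longleftrightarrow>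
        (\<exists>h. trigger (rename_fact \<pi> ` I) \<sigma> h \<and> b \<in> inst (extend \<sigma> h) ` set (head \<sigma>))" by blast
      \<comment> \<open>Substitute \<open>rename_val \<pi> \<circ> h\<close> for \<open>h\<close>:
        triggers and their results are then transported by \<open>rename_fact \<pi>\<close>.\<close>
      also have "\<dots> \<longleftrightarrow> (\<exists>h. trigger I \<sigma> h \<and> b \<in> rename_fact \<pi> ` inst (extend \<sigma> h) ` set (head \<sigma>))"
        by (subst ex_assignment_rename[OF bij]) (simp add: trigger_rename[OF that] inst_image_head[OF that])
      also have "\<dots> \<longleftrightarrow> b \<in> rename_fact \<pi> ` (\<Union>h\<in>{h. trigger I \<sigma> h}. inst (extend \<sigma> h) ` set (head \<sigma>))"
        by blast
      finally show ?thesis .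
    qed
    then show ?thesis by (rule set_eqI)
  qed
  then show ?thesis
    unfolding chase_step_def by (simp add: image_Un image_UN)
qed

lemma chase_rename: "chase (rename_fact \<pi> ` D) \<Sigma> = rename_fact \<pi> ` chase D \<Sigma>"
proof -
  have "(chase_step \<Sigma> ^^ i) (rename_fact \<pi> ` D) = rename_fact \<pi> ` (chase_step \<Sigma> ^^ i) D" for i
    by (induction i) (simp_all add: chase_step_rename)
  then show ?thesis by (simp add: chase_def image_UN)
qed

end

text \<open>The renaming itself serves as isomorphism: it carries the whole chase of
  \<open>G\<close> to that of \<open>H\<close>, and every rule application to one of the same rule,
  so arcs keep all their labels.\<close>

lemma chase_isomorphism_rename:
  fixes G H :: "('v, 'l) graph"
  assumes bij: "bij \<pi>" and fixed: "\<And>\<sigma> c. \<sigma> \<in> \<Sigma> \<Longrightarrow> c \<in> rule_consts \<sigma> \<Longrightarrow> \<pi> c = c"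
    and facts: "graph_facts H = rename_fact \<pi> ` graph_facts G"
    and verts: "vertex_fact ` verts H = rename_fact \<pi> ` (vertex_fact ` verts G :: ('v, 'l) gfact set)"
  shows "chase_isomorphism \<Sigma> G H (rename_fact \<pi>)"
proof -
  have inj: "inj (rename_fact \<pi>)"
    using bij_rename_fact[OF bij] by (rule bij_is_inj)
  have nodes: "chase_nodes H \<Sigma> = rename_fact \<pi> ` chase_nodes G \<Sigma>"
    unfolding chase_nodes_def facts by (rule chase_rename[OF bij fixed])
  have arcs: "(rename_fact \<pi> a, \<sigma>, rename_fact \<pi> b) \<in> chase_arcs H \<Sigma> \<longleftrightarrow> (a, \<sigma>, b) \<in> chase_arcs G \<Sigma>"
    for a \<sigma> b
  proof (cases "\<sigma> \<in> \<Sigma>")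
    case True
    show ?thesis
      unfolding chase_arcs_def nodes
      by (simp add: True, subst ex_assignment_rename[OF bij])
        (simp add: trigger_rename[OF bij fixed True] inst_image_body[OF bij fixed True]
          inst_image_head[OF bij fixed True] inj_image_mem_iff[OF inj])
  qed (simp add: chase_arcs_def)
  show ?thesis
    unfolding chase_isomorphism_def
    using inj by (auto simp: arcs nodes verts bij_betw_def intro: inj_on_subset)
qed

section \<open>Chase-isomorphisms between induced subgraphs\<close>

text \<open>The complements of \<open>X\<close> and of its image within their union are
  equinumerous, so \<open>f\<close> completes to a permutation of that union. Being the identity
  elsewhere is what later leaves the labels in rules alone.\<close>

lemma inj_on_finite_extends_to_bij:
  assumes "finite X" "inj_on f X"
  obtains g where "bij g" "\<And>x. x \<in> X \<Longrightarrow> g x = f x" "\<And>x. x \<notin> X \<union> f ` X \<Longrightarrow> g x = x"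
proof -
  let ?Y = "X \<union> f ` X"
  have *: "card (?Y - X) = card (?Y - f ` X)"
    using assms by (simp add: card_Diff_subset card_image)
  then obtain h where h: "bij_betw h (?Y - X) (?Y - f ` X)"
    using finite_same_card_bij[OF _ _ *] assms(1) by auto
  define g where "g = (\<lambda>x. if x \<in> X then f x else if x \<in> ?Y then h x else x)"
  have 1: "bij_betw g X (f ` X)"
    using assms(2) by (auto simp: g_def bij_betw_def inj_on_def)
  have 2: "bij_betw g (?Y - X) (?Y - f ` X)"
    using h by (subst bij_betw_cong[where g = h]) (auto simp: g_def)
  have 3: "bij_betw g (- ?Y) (- ?Y)"
    by (subst bij_betw_cong[where g = id]) (auto simp: g_def)
  have "bij_betw g (X \<union> (?Y - X)) (f ` X \<union> (?Y - f ` X))"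
    using 1 2 by (rule bij_betw_combine) auto
  moreover have "X \<union> (?Y - X) = ?Y" "f ` X \<union> (?Y - f ` X) = ?Y" by auto
  ultimately have "bij_betw g ?Y ?Y" by simp
  then have "bij_betw g (?Y \<union> - ?Y) (?Y \<union> - ?Y)"
    using 3 by (rule bij_betw_combine) auto
  then have "bij g" by (simp only: Compl_partition)
  then show thesis using that[of g] by (auto simp: g_def)
qed

text \<open>Weights and data values stay fixed, so rules may mention them; only vertices and labels
  are moved.\<close>

fun rename_const :: "('v \<Rightarrow> 'v) \<Rightarrow> ('l \<Rightarrow> 'l) \<Rightarrow> ('v, 'l) const \<Rightarrow> ('v, 'l) const" where
  "rename_const g g' (VertexC v) = VertexC (g v)"
| "rename_const g g' (LabelC l) = LabelC (g' l)"
| "rename_const g g' (WeightC w) = WeightC w"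
| "rename_const g g' (DataC s) = DataC s"

lemma bij_rename_const:
  assumes "bij g" "bij g'"
  shows "bij (rename_const g g')"
proof (rule o_bij[where g = "rename_const (inv g) (inv g')"])
  have "rename_const (inv g) (inv g') (rename_const g g' c) = c" for c
    using assms by (cases c) (auto simp: bij_is_inj)
  then show "rename_const (inv g) (inv g') \<circ> rename_const g g' = id" by (simp add: fun_eq_iff)
  have "rename_const g g' (rename_const (inv g) (inv g') c) = c" for c
    using assms by (cases c) (auto simp: bij_is_surj surj_f_inv_f)
  then show "rename_const g g' \<circ> rename_const (inv g) (inv g') = id" by (simp add: fun_eq_iff)
qed

text \<open>The labels of \<open>A\<close> are pairwise distinct, so a renaming of vertices induces one of labels;
  together they give a renaming of constants that fixes the constants of the rules.\<close>

lemma chase_isomorphism_induced: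
  fixes A :: "('v, 'l) graph"
  assumes fin: "finite X" and X: "X \<subseteq> verts A" "f ` X \<subseteq> verts A" and inj: "inj_on f X"
    and lab: "inj_on (label A) (verts A)"
    and edges: "\<And>u v. u \<in> X \<Longrightarrow> v \<in> X \<Longrightarrow> (f u, f v) \<in> edges A \<longleftrightarrow> (u, v) \<in> edges A"
    and weight: "\<And>u v. u \<in> X \<Longrightarrow> v \<in> X \<Longrightarrow> (u, v) \<in> edges A \<Longrightarrow>
      weight A (f u, f v) = weight A (u, v)"
    and rule_free: "\<And>\<sigma>. \<sigma> \<in> \<Sigma> \<Longrightarrow>
      rule_consts \<sigma> \<inter> (range VertexC \<union> LabelC ` label A ` verts A) = {}"
  obtains \<Psi> where "chase_isomorphism \<Sigma> (induced A X) (induced A (f ` X)) \<Psi>"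
    "\<And>v. v \<in> X \<Longrightarrow> on_verts \<Psi> v = f v"
proof -
  obtain g where g: "bij g" "\<And>x. x \<in> X \<Longrightarrow> g x = f x"
    by (rule inj_on_finite_extends_to_bij[OF fin inj]) blast
  \<comment> \<open>\<open>r\<close> is the map on labels induced by \<open>f\<close>, well defined
    because labels are injective on \<open>X\<close>.\<close>
  define r where "r = label A \<circ> f \<circ> inv_into X (label A)"
  have labX: "inj_on (label A) X" using lab X by (meson inj_on_subset)
  have r: "r (label A v) = label A (f v)" if "v \<in> X" for v
    using that labX by (simp add: r_def)
  have "inj_on r (label A ` X)"
    using comp_inj_on[OF inj inj_on_subset[OF lab X(2)]] by (auto simp: inj_on_def r)
  then obtain g' where g': "bij g'" "\<And>l. l \<in> label A ` X \<Longrightarrow> g' l = r l"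
    "\<And>l. l \<notin> label A ` X \<union> r ` label A ` X \<Longrightarrow> g' l = l"
    by (rule inj_on_finite_extends_to_bij[OF finite_imageI[OF fin]]) blast
  let ?\<pi> = "rename_const g g'"
  have fixed: "?\<pi> c = c" if "\<sigma> \<in> \<Sigma>" "c \<in> rule_consts \<sigma>" for \<sigma> c
  proof (cases c)
    case (LabelC l)
    \<comment> \<open>\<open>g'\<close> moves only labels of vertices of \<open>A\<close>, and no
      rule mentions those.\<close>
    have "r ` label A ` X \<subseteq> label A ` verts A" using X r by (auto simp: image_subset_iff)
    moreover have "l \<notin> label A ` verts A" using rule_free[OF that(1)] that(2) LabelC by auto
    ultimately show ?thesis using g'(3)[of l] LabelC X by auto
  qed (use rule_free[OF that(1)] that(2) in auto)
  have vf: "rename_fact ?\<pi> (vertex_fact v) = vertex_fact (f v)" if "v \<in> X" for v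
    using that by (simp add: vertex_fact_def g)
  have vX: "verts (induced A X) = X" "verts (induced A (f ` X)) = f ` X"
    using X by (auto simp: induced_def)
  have verts: "vertex_fact ` verts (induced A (f ` X)) =
      rename_fact ?\<pi> ` vertex_fact ` verts (induced A X)"
    unfolding vX image_image by (intro image_cong refl) (simp add: vf)
  let ?ef = "\<lambda>(u, v). Fact EdgeP [Val (VertexC u), Val (VertexC v), Val (WeightC (weight A (u, v)))] :: ('v,'l) gfact"
  let ?lf = "\<lambda>v. Fact LabelP [Val (VertexC v), Val (LabelC (label A v))] :: ('v,'l) gfact"
  have gf: "graph_facts (induced A Y) = vertex_fact ` verts (induced A Y) \<union>
      ?ef ` (edges A \<inter> Y \<times> Y) \<union> ?lf ` verts (induced A Y)" for Y
    by (auto simp: graph_facts_def induced_def)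
  have "edges A \<inter> (f ` X) \<times> (f ` X) = map_prod f f ` (edges A \<inter> X \<times> X)"
  proof (intro subset_antisym subsetI)
    fix e assume "e \<in> edges A \<inter> (f ` X) \<times> (f ` X)"
    then obtain u v where "u \<in> X" "v \<in> X" "e = (f u, f v)" "(u, v) \<in> edges A"
      using edges by auto
    then show "e \<in> map_prod f f ` (edges A \<inter> X \<times> X)"
      by (intro image_eqI[of _ _ "(u, v)"]) auto
  next
    fix e assume "e \<in> map_prod f f ` (edges A \<inter> X \<times> X)"
    then show "e \<in> edges A \<inter> (f ` X) \<times> (f ` X)" using edges by auto
  qed
  then have ef: "?ef ` (edges A \<inter> (f ` X) \<times> (f ` X)) = rename_fact ?\<pi> ` ?ef ` (edges A \<inter> X \<times> X)"
    by (simp only: image_image) (rule image_cong[OF refl], auto simp: g weight)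
  have lf: "?lf ` verts (induced A (f ` X)) = rename_fact ?\<pi> ` ?lf ` verts (induced A X)"
    unfolding vX image_image by (intro image_cong refl) (simp add: g g' r)
  have "graph_facts (induced A (f ` X)) = rename_fact ?\<pi> ` graph_facts (induced A X)"
    unfolding gf verts ef lf image_Un ..
  from chase_isomorphism_rename[OF bij_rename_const[OF g(1) g'(1)] fixed this verts]
  have "chase_isomorphism \<Sigma> (induced A X) (induced A (f ` X)) (rename_fact ?\<pi>)" .
  moreover have "on_verts (rename_fact ?\<pi>) v = f v" if "v \<in> X" for v
    using vf[OF that] by (auto simp: on_verts_def vertex_fact_def)
  ultimately show thesis by (rule that)
qed

section \<open>Step 3 of the algorithm\<close>

text \<open>Each iteration raises \<delta> above a used number, so fewer used numbers remain at or
  above it; this bounds the iterations by \<open>card used\<close>. With all draws at most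
  \<open>n\<close>, an iteration raises \<open>max \<delta> n\<close> by at most one.\<close>

lemma find_delta_terminates:
  assumes "finite used"
  obtains \<delta> t where "find_delta used z \<delta>0 = Some (\<delta>, t)" "\<delta> \<notin> used" "\<delta>0 \<le> \<delta>" "t \<le> card used"
    "\<And>n. (\<And>t. z t \<le> n) \<Longrightarrow> \<delta> \<le> max \<delta>0 n + t"
proof -
  let ?loop = "while_option (\<lambda>(\<delta>, t). \<delta> \<in> used) (\<lambda>(\<delta>, t). (max (\<delta> + 1) (z t), t + 1))"
  have unfold: "?loop (\<delta>, t) = (if \<delta> \<in> used then ?loop (max (\<delta> + 1) (z t), t + 1) else Some (\<delta>, t))" for \<delta> t
    using while_option_unfold[of "\<lambda>(\<delta>, t). \<delta> \<in> used" _ "(\<delta>, t)"] by (simp only: case_prod_conv)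
  \<comment> \<open>Generalised to an arbitrary counter \<open>t\<close>; the last bound has sums on
    both sides to avoid truncated subtraction.\<close>
  have "\<exists>\<delta>' t'. ?loop (\<delta>, t) = Some (\<delta>', t') \<and> \<delta>' \<notin> used \<and> \<delta> \<le> \<delta>' \<and>
      t \<le> t' \<and> t' \<le> t + card {u \<in> used. \<delta> \<le> u} \<and> (\<forall>n. (\<forall>t. z t \<le> n) \<longrightarrow> \<delta>' + t \<le> max \<delta> n + t')" for \<delta> t
  proof (induction "card {u \<in> used. \<delta> \<le> u}" arbitrary: \<delta> t rule: less_induct)
    case less
    show ?case
    proof (cases "\<delta> \<in> used")
      case False
      then have "?loop (\<delta>, t) = Some (\<delta>, t)" using unfold[of \<delta> t] by (simp only: if_False)
      then show ?thesis using False by (intro exI[of _ \<delta>] exI[of _ t]) simp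
    next
      case True
      let ?\<delta> = "max (\<delta> + 1) (z t)"
      have "\<delta> \<in> {u \<in> used. \<delta> \<le> u}" "\<delta> \<notin> {u \<in> used. ?\<delta> \<le> u}" using True by simp_all
      moreover have "{u \<in> used. ?\<delta> \<le> u} \<subseteq> {u \<in> used. \<delta> \<le> u}" by (rule Collect_mono) simp
      ultimately have "{u \<in> used. ?\<delta> \<le> u} \<subset> {u \<in> used. \<delta> \<le> u}" by blast
      then have lt: "card {u \<in> used. ?\<delta> \<le> u} < card {u \<in> used. \<delta> \<le> u}"
        using assms by (intro psubset_card_mono) auto
      from less[OF this, of "t + 1"] obtain \<delta>' t' where IH: "?loop (?\<delta>, t + 1) = Some (\<delta>', t')"
        "\<delta>' \<notin> used" "?\<delta> \<le> \<delta>'" "t + 1 \<le> t'" "t' \<le> t + 1 + card {u \<in> used. ?\<delta> \<le> u}"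
        "\<forall>n. (\<forall>t. z t \<le> n) \<longrightarrow> \<delta>' + (t + 1) \<le> max ?\<delta> n + t'" by blast
      have "\<delta>' + t \<le> max \<delta> n + t'" if "\<forall>t. z t \<le> n" for n
      proof -
        have "\<delta>' + (t + 1) \<le> max ?\<delta> n + t'" "z t \<le> n" using IH(6) that by blast+
        then show ?thesis by (simp add: max_def split: if_splits)
      qed
      moreover have "?loop (\<delta>, t) = Some (\<delta>', t')"
        using True IH(1) unfold[of \<delta> t] by (simp only: if_True)
      ultimately show ?thesis using IH lt by (intro exI[of _ \<delta>'] exI[of _ t']) auto
    qed
  qed
  from this[of \<delta>0 0] obtain \<delta> t where 1: "?loop (\<delta>0, 0) = Some (\<delta>, t)" "\<delta> \<notin> used" "\<delta>0 \<le> \<delta>"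
     "t \<le> card {u \<in> used. \<delta>0 \<le> u}" "\<forall>n. (\<forall>t. z t \<le> n) \<longrightarrow> \<delta> \<le> max \<delta>0 n + t" by auto
  have "card {u \<in> used. \<delta>0 \<le> u} \<le> card used" using assms by (intro card_mono) auto
  with 1 show thesis by (intro that[of \<delta> t]) (auto simp: find_delta_def)
qed

text \<open>\<open>P i\<close> is the loop invariant just before iteration \<open>i\<close>; the
  conclusion includes that no iteration fails.\<close>

lemma iterate_upt:
  assumes "a \<le> b" "P a s"
    and "\<And>i s. a \<le> i \<Longrightarrow> i < b \<Longrightarrow> P i s \<Longrightarrow> \<exists>s'. f i s = Some s' \<and> P (Suc i) s'"
  shows "\<exists>s'. iterate f [a..<b] s = Some s' \<and> P b s'"
  using assms
proof (induction "b - a" arbitrary: a s)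
  case (Suc m)
  then have ab: "a < b" "m = b - Suc a" by auto
  obtain s1 where s1: "f a s = Some s1" "P (Suc a) s1" using Suc.prems(2,3) ab by blast
  have "\<exists>s'. iterate f [Suc a..<b] s1 = Some s' \<and> P b s'"
    using Suc.hyps(1)[OF ab(2) _ s1(2)] Suc.prems(3) ab(1) by simp
  then show ?case using s1 ab by (simp add: upt_conv_Cons)
qed simp

text \<open>A star between \<open>v\<close> and \<open>T\<close> changes the
  \<open>d\<close>-neighbours only at its centre and the opposite neighbours only at its tips, so
  vertices outside both keep their degrees.\<close>

lemma nbrs_add_star:
  assumes "edges B = edges A \<union> (case d of In \<Rightarrow> T \<times> {v} | Out \<Rightarrow> {v} \<times> T)"
  shows "nbrs d' B u = nbrs d' A u \<union>
    (if d' = d then if u = v then T else {} else if u \<in> T then {v} else {})"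
  by (cases d; cases d') (auto simp: assms)

section \<open>Copies of the vertices in a fixed run\<close>

text \<open>In the application \<open>G\<close> is the graph already reweighted in step 1, and
  \<open>z\<close> holds the degree draws of one fixed sample.\<close>

locale klone_run =
  fixes G :: "('v, 'l) graph" and k :: nat and LA :: "'l set" and ch :: "('v, 'l) choices"
    and z :: "dir \<times> nat \<times> nat \<times> nat \<Rightarrow> nat"
  assumes wf: "wf_graph G" and nonempty: "verts G \<noteq> {}" and k: "1 \<le> k"
    and valid: "valid_choices G k LA ch"
begin

definition part :: "nat \<Rightarrow> 'v set" where
  "part j = copy ch j ` verts G"

definition V0 :: "'v set" where
  "V0 = (\<Union>j\<in>{1..k}. part j)"

definition A0 :: "('v, 'l) graph" where
  "A0 = disjoint_copies k (copy ch) G"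

abbreviation n :: nat where
  "n \<equiv> card (verts G)"

text \<open>The vertex \<open>v\<^sub>i\<^sup>j\<close> of the algorithm; lists count from 0, the
  algorithm from 1.\<close>

definition vx :: "nat \<Rightarrow> nat \<Rightarrow> 'v" where
  "vx i j = copy ch j (vertex_list ch ! (i - 1))"

lemma fin: "finite (verts G)" and edges_G: "edges G \<subseteq> verts G \<times> verts G"
  using wf by (auto simp: wf_graph_def)

lemma n_pos: "1 \<le> n"
  using fin nonempty by (simp add: Suc_leI card_gt_0_iff)

lemma le_kn: "1 \<le> k * n" "k \<le> k * n" "n \<le> k * n"
  using k n_pos by auto

lemma copy_1: "v \<in> verts G \<Longrightarrow> copy ch 1 v = v"
  using valid by (auto simp: valid_choices_def)

lemma copy_inj:
  assumes "copy ch j u = copy ch j' v" "j \<in> {1..k}" "j' \<in> {1..k}" "u \<in> verts G" "v \<in> verts G"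
  shows "j = j'" "u = v"
proof -
  have "inj_on (\<lambda>(j, v). copy ch j v) ({1..k} \<times> verts G)"
    using valid by (auto simp: valid_choices_def)
  from inj_onD[OF this, of "(j, u)" "(j', v)"] assms show "j = j'" "u = v" by auto
qed

lemma part_disjoint: "j \<in> {1..k} \<Longrightarrow> j' \<in> {1..k} \<Longrightarrow> j \<noteq> j' \<Longrightarrow> part j \<inter> part j' = {}"
  using copy_inj by (fastforce simp: part_def)

lemma fin_V0: "finite V0"
  using fin by (auto simp: V0_def part_def)

lemma card_V0: "card V0 = k * n"
proof -
  have "V0 = (\<lambda>(j, v). copy ch j v) ` ({1..k} \<times> verts G)"
    by (auto simp: V0_def part_def)
  moreover have "inj_on (\<lambda>(j, v). copy ch j v) ({1..k} \<times> verts G)"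
    using valid by (auto simp: valid_choices_def)
  ultimately show ?thesis by (simp add: card_image card_cartesian_product)
qed

lemma vertex_list: "distinct (vertex_list ch)" "set (vertex_list ch) = verts G"
  "length (vertex_list ch) = n"
  using valid distinct_card[of "vertex_list ch"] by (auto simp: valid_choices_def)

lemma vertex_list_nth: "i \<in> {1..n} \<Longrightarrow> vertex_list ch ! (i - 1) \<in> verts G"
  using vertex_list(2,3) by (metis atLeastAtMost_iff diff_less le_zero_eq less_one nth_mem
      order_less_le_trans linorder_not_le not_gr_zero)

lemma vx_in_part: "i \<in> {1..n} \<Longrightarrow> vx i j \<in> part j"
  using vertex_list_nth by (auto simp: vx_def part_def)

lemma part_subset: "j \<in> {1..k} \<Longrightarrow> part j \<subseteq> V0"
  by (auto simp: V0_def)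

lemma vx_inj:
  assumes "vx i j = vx i' j'" "i \<in> {1..n}" "i' \<in> {1..n}" "j \<in> {1..k}" "j' \<in> {1..k}"
  shows "i = i'" "j = j'"
proof -
  show "j = j'" using assms copy_inj vertex_list_nth unfolding vx_def by blast
  have "vertex_list ch ! (i - 1) = vertex_list ch ! (i' - 1)"
    using assms copy_inj vertex_list_nth unfolding vx_def by blast
  then have "i - 1 = i' - 1"
    using assms vertex_list by (subst (asm) nth_eq_iff_index_eq) auto
  then show "i = i'" using assms by auto
qed

lemma new_vertex: "inj (new_vertex ch)" "new_vertex ch m \<notin> V0"
  using valid by (auto simp: valid_choices_def V0_def part_def)

lemma select:
  "finite C \<Longrightarrow> \<Delta> \<le> card C \<Longrightarrow> select ch d i j C \<Delta> \<subseteq> C \<and> card (select ch d i j C \<Delta>) = \<Delta>"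
  using valid by (auto simp: valid_choices_def)

section \<open>Invariant and cost account of step 3\<close>

text \<open>\<open>R\<close> collects the pairs \<open>(d, v)\<close> such that step 3 has been carried out for \<open>v\<close> and
  \<open>d\<close> although \<open>v\<close> is not yet in \<open>\<V>\<close>. For all other unseen copies, no vertex created in
  step 3(c) is a neighbour, which bounds their degrees by \<open>kn\<close>.\<close>

definition invariant :: "(dir \<times> 'v) set \<Rightarrow> ('v, 'l) state \<Rightarrow> bool" where
  "invariant R st \<longleftrightarrow>
     verts (cur st) = V0 \<union> new_vertex ch ` {..<news st} \<and>
     edges A0 \<subseteq> edges (cur st) \<and> edges (cur st) \<subseteq> verts (cur st) \<times> verts (cur st) \<and>
     (\<forall>j\<in>{1..k}. edges (cur st) \<inter> part j \<times> part j \<subseteq> edges A0) \<and>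
     weight (cur st) = weight A0 \<and> seen st \<subseteq> V0 \<and>
     (\<forall>u\<in>V0 - seen st. \<forall>d. (d, u) \<notin> R \<longrightarrow> nbrs d (cur st) u \<subseteq> V0)"

text \<open>The vertices created in step 3(c) pay for their own rows and columns.\<close>

definition budget :: "nat \<Rightarrow> ('v, 'l) state \<Rightarrow> ('v, 'l) state \<Rightarrow> bool" where
  "budget c st st' \<longleftrightarrow> ((\<forall>q. z q \<le> n) \<longrightarrow> news st \<le> 2 * (k * n) \<longrightarrow>
     news st' \<le> 2 * (k * n) \<and>
     clock st' + 6 * (k * n) * news st \<le> clock st + c + 6 * (k * n) * news st')"

lemma budget_refl: "budget 0 st st"
  by (simp add: budget_def)

text \<open>The bound on \<open>news\<close> is both assumed and concluded, so budgets of
  consecutive parts of the program add up.\<close>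

lemma budget_trans: "budget c st st' \<Longrightarrow> budget c' st' st'' \<Longrightarrow> budget (c + c') st st''"
  unfolding budget_def by auto

lemma budget_mono: "budget c st st' \<Longrightarrow> c \<le> c' \<Longrightarrow> budget c' st st'"
  unfolding budget_def by force

lemma invariant_card_verts: "invariant R st \<Longrightarrow> finite (verts (cur st)) \<and> card (verts (cur st)) = k * n + news st"
proof -
  assume "invariant R st"
  then have v: "verts (cur st) = V0 \<union> new_vertex ch ` {..<news st}" by (simp add: invariant_def)
  have "card (new_vertex ch ` {..<news st}) = news st"
    using new_vertex(1) by (subst card_image) (auto intro: inj_on_subset)
  moreover have "V0 \<inter> new_vertex ch ` {..<news st} = {}" using new_vertex(2) by auto
  ultimately show ?thesis unfolding v using fin_V0 by (simp add: card_Un_disjoint card_V0)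
qed

lemma finite_nbrs: "invariant R st \<Longrightarrow> finite (nbrs d (cur st) u)"
proof -
  assume i: "invariant R st"
  then have "nbrs d (cur st) u \<subseteq> verts (cur st)" by (cases d) (auto simp: invariant_def)
  then show ?thesis using invariant_card_verts[OF i] finite_subset by blast
qed

section \<open>Step 3 for one direction, one copy, one vertex\<close>

text \<open>The selected set \<open>T\<close> avoids the neighbours of the vertex, so the degree
  grows by exactly \<Delta>; it avoids \<open>seen\<close>, so finished degrees stay; it avoids copy
  \<open>j\<close>, so no edge inside a copy appears. The vertex itself is not in \<open>T\<close>,
  which leaves the other direction alone.\<close>

lemma adjust_degree:
  assumes inv: "invariant R st" and j: "j \<in> {1..k}" and i: "i \<in> {1..n}"
    and v: "vx i j \<notin> seen st" "(d, vx i j) \<notin> R" and len: "length (deltas st d) \<le> k"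
  obtains st' \<delta> where "adjust_degree G ch z i j d st = Some st'"
    "invariant (insert (d, vx i j) R) st'" "seen st' = seen st"
    "deltas st' = (deltas st)(d := deltas st d @ [\<delta>])" "\<delta> \<notin> set (deltas st d)"
    "deg d (cur st') (vx i j) = \<delta>"
    "\<And>d'. d' \<noteq> d \<Longrightarrow> nbrs d' (cur st') (vx i j) = nbrs d' (cur st) (vx i j)"
    "\<And>d' u. u \<in> seen st \<Longrightarrow> nbrs d' (cur st') u = nbrs d' (cur st) u"
    "budget (16 * (k * n)) st st'"
proof -
  define v where "v = vx i j"
  define A where "A = cur st"
  obtain \<delta> t where \<delta>: "find_delta (set (deltas st d)) (\<lambda>t. z (d, i, j, t)) (deg d A v) = Some (\<delta>, t)"
    "\<delta> \<notin> set (deltas st d)" "deg d A v \<le> \<delta>" "t \<le> card (set (deltas st d))"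
    "\<And>n. (\<And>t. z (d, i, j, t) \<le> n) \<Longrightarrow> \<delta> \<le> max (deg d A v) n + t"
    by (rule find_delta_terminates[of "set (deltas st d)" "\<lambda>t. z (d, i, j, t)" "deg d A v"]) auto
  define \<Delta> where "\<Delta> = \<delta> - deg d A v"
  define C where "C = {u \<in> verts A. u \<notin> nbrs d A v \<union> seen st \<union> part j}"
  define m where "m = \<Delta> - card C"
  define N where "N = new_vertex ch ` {news st ..< news st + m}"
  define T where "T = select ch d i j (C \<union> N) \<Delta>"
  define A' where "A' = A\<lparr>verts := verts A \<union> N,
                   edges := edges A \<union> (case d of In \<Rightarrow> T \<times> {v} | Out \<Rightarrow> {v} \<times> T)\<rparr>"
  define st' where "st' = st\<lparr>cur := A', deltas := (deltas st)(d := deltas st d @ [\<delta>]), news := news st + m,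
          clock := clock st + card (verts A) + (3 * t + 1) + 1 + card (verts A)
                   + m * (2 * card (verts A')) + card (C \<union> N) + \<Delta>\<rparr>"
  have run: "adjust_degree G ch z i j d st = Some st'"
    unfolding adjust_degree_def Let_def vx_def[symmetric] v_def[symmetric] A_def[symmetric] \<delta>(1)
    by (simp only: Option.bind_lunit case_prod_conv st'_def A'_def T_def N_def m_def C_def \<Delta>_def part_def)
  have vV: "v \<in> part j" "v \<in> V0" using vx_in_part[OF i] part_subset[OF j] by (auto simp: v_def)
  have vA: "verts A = V0 \<union> new_vertex ch ` {..<news st}" using inv by (simp add: invariant_def A_def)
  have finA: "finite (verts A)" "card (verts A) = k * n + news st"
    using invariant_card_verts[OF inv] by (auto simp: A_def)
  have finCN: "finite C" "finite N" using finA by (auto simp: C_def N_def)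
  have N_disj: "N \<inter> verts A = {}"
    using new_vertex by (auto simp: N_def vA inj_eq)
  have card_N: "card N = m"
    unfolding N_def using new_vertex(1) by (subst card_image) (auto intro: inj_on_subset)
  have "C \<inter> N = {}" using N_disj by (auto simp: C_def)
  then have card_CN: "card (C \<union> N) = card C + m"
    using finCN card_N by (simp add: card_Un_disjoint)
  then have "\<Delta> \<le> card (C \<union> N)" by (auto simp: m_def)
  then have T: "T \<subseteq> C \<union> N" "card T = \<Delta>" using select[of "C \<union> N" \<Delta> d i j] finCN by (auto simp: T_def)
  have eA: "edges A \<subseteq> verts A \<times> verts A" using inv unfolding invariant_def A_def by blast
  then have nA: "nbrs d A v \<subseteq> verts A" by (cases d) auto
  have T_disj: "T \<inter> nbrs d A v = {}" "T \<inter> seen st = {}" "T \<inter> part j = {}"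
    using T(1) nA N_disj vA inv part_subset[OF j] by (auto simp: C_def invariant_def)
  then have vT: "v \<notin> T" using vV by auto
  have finT: "finite T" using T(1) finCN by (meson finite_UnI finite_subset)
  \<comment> \<open>The vertex is unseen and direction \<open>d\<close> has not been treated yet, so
    the invariant excludes neighbours made in step 3(c).\<close>
  have nbrs_v0: "nbrs d A v \<subseteq> V0"
    using inv assms(4,5) vV unfolding invariant_def A_def v_def by auto
  have nbrs': "nbrs d' A' u = nbrs d' A u \<union>
      (if d' = d then if u = v then T else {} else if u \<in> T then {v} else {})" for d' u
    by (rule nbrs_add_star) (simp add: A'_def)
  have deg': "deg d A' v = \<delta>"
  proof -
    have "deg d A' v = deg d A v + \<Delta>"
      using T_disj finT finite_nbrs[OF inv] T(2)
      by (simp add: deg_def nbrs' card_Un_disjoint A_def Int_commute)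
    then show ?thesis using \<delta>(3) by (simp add: \<Delta>_def)
  qed
  have vA': "verts A' = V0 \<union> new_vertex ch ` {..<news st + m}"
    by (auto simp: A'_def vA N_def) (metis atLeastLessThan_iff imageI lessThan_iff not_le_imp_less)
  have eA': "edges A' \<subseteq> verts A' \<times> verts A'"
    using eA T(1) vV vA by (auto simp: A'_def C_def split: dir.splits)
  have part': "edges A' \<inter> part j' \<times> part j' \<subseteq> edges A0" if "j' \<in> {1..k}" for j'
  proof -
    have "edges A \<inter> part j' \<times> part j' \<subseteq> edges A0" using inv that unfolding invariant_def A_def by blast
    \<comment> \<open>Each new edge joins \<open>v\<close> to a member of \<open>T\<close>:
      \<open>v\<close> lies only in part \<open>j\<close>, and \<open>T\<close> misses part
      \<open>j\<close>.\<close>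
    moreover have "v \<notin> part j' \<or> T \<inter> part j' = {}"
      using part_disjoint[OF j that] vV(1) T_disj(3) by (cases "j = j'") auto
    ultimately show ?thesis by (auto simp: A'_def split: dir.splits)
  qed
  have inv': "invariant (insert (d, v) R) st'"
    unfolding invariant_def
  proof (intro conjI ballI allI impI)
    fix u d' assume u: "u \<in> V0 - seen st'" "(d', u) \<notin> insert (d, v) R"
    then have "nbrs d' A u \<subseteq> V0" using inv by (auto simp: invariant_def st'_def A_def)
    moreover have "\<not> (d' = d \<and> u = v)" using u by auto
    \<comment> \<open>The only neighbour that \<open>u\<close> can gain is \<open>v\<close>, which
      lies in \<open>V0\<close>.\<close>
    ultimately show "nbrs d' (cur st') u \<subseteq> V0" using vV by (auto simp: st'_def nbrs')
  qed (use inv eA' vA' part' in \<open>auto simp: st'_def invariant_def A_def A'_def\<close>)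
  have "budget (16 * (k * n)) st st'"
    unfolding budget_def
  proof (intro impI)
    assume z: "\<forall>q. z q \<le> n" and news: "news st \<le> 2 * (k * n)"
    have "deg d A v \<le> k * n"
      using nbrs_v0 card_mono[OF fin_V0] by (simp add: deg_def card_V0)
    moreover have t: "t \<le> k" using \<delta>(4) len card_length[of "deltas st d"] by linarith
    moreover have "\<delta> \<le> max (deg d A v) n + t" using z \<delta>(5) by blast
    \<comment> \<open>The bound is \<open>k * n + k\<close>, and
      \<open>k \<le> k * n\<close>.\<close>
    ultimately have \<delta>_le: "\<delta> \<le> 2 * (k * n)" using le_kn by linarith
    then have \<Delta>_le: "\<Delta> \<le> 2 * (k * n)" by (simp add: \<Delta>_def)
    \<comment> \<open>All earlier new vertices are candidates: they are no neighbours of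
      \<open>v\<close>, and \<open>seen\<close> and part \<open>j\<close> lie in \<open>V0\<close>.
      So creating vertices brings the total number of new ones to at most \<Delta>.\<close>
    have "new_vertex ch ` {..<news st} \<subseteq> C"
      using nbrs_v0 new_vertex(2) inv part_subset[OF j] by (auto simp: C_def vA invariant_def)
    then have "card (new_vertex ch ` {..<news st}) \<le> card C" using finCN by (intro card_mono)
    moreover have "card (new_vertex ch ` {..<news st}) = news st"
      using new_vertex(1) by (subst card_image) (auto intro: inj_on_subset)
    ultimately have news': "news st + m \<le> 2 * (k * n)"
      using news \<Delta>_le by (simp add: m_def)
    have "card (verts A') = k * n + (news st + m)"
      using invariant_card_verts[OF inv'] by (simp add: st'_def)
    \<comment> \<open>A new vertex costs a row and a column of at most \<open>3 * (k * n)\<close>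
      entries each, exactly what \<open>budget\<close> grants per unit of
      \<open>news\<close>.\<close>
    then have "m * (2 * card (verts A')) \<le> m * (2 * (3 * (k * n)))"
      using news' by (intro mult_le_mono2) simp
    moreover have "card (C \<union> N) \<le> 3 * (k * n)"
    proof -
      have "card C \<le> card (verts A)" using finA by (intro card_mono) (auto simp: C_def)
      then show ?thesis using card_CN finA news' by simp
    qed
    moreover have "6 * (k * n) * (news st + m) = 6 * (k * n) * news st + m * (2 * (3 * (k * n)))"
      by (simp add: algebra_simps)
    moreover have "clock st' = clock st + card (verts A) + (3 * t + 1) + 1 + card (verts A)
        + m * (2 * card (verts A')) + card (C \<union> N) + \<Delta>"
      by (simp add: st'_def)
    \<comment> \<open>The 16 units of \<open>k * n\<close> are 6 for scanning the degree and the
      candidates, 5 for the while loop and the subtraction, 3 for the pool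
      \<open>C \<union> N\<close>, and 2 for the new edges.\<close>
    ultimately have "clock st' + 6 * (k * n) * news st \<le> clock st + 16 * (k * n) + 6 * (k * n) * (news st + m)"
      using finA(2) t \<Delta>_le le_kn news by linarith
    then show "news st' \<le> 2 * (k * n) \<and>
       clock st' + 6 * (k * n) * news st \<le> clock st + 16 * (k * n) + 6 * (k * n) * news st'"
      using news' by (simp add: st'_def)
  qed
  moreover have "nbrs d' (cur st') (vx i j) = nbrs d' (cur st) (vx i j)" if "d' \<noteq> d" for d'
    using that vT nbrs'[of d' v] by (simp add: st'_def A_def v_def)
  moreover have "nbrs d' (cur st') u = nbrs d' (cur st) u" if "u \<in> seen st" for d' u
    using that T_disj(2) assms(4) nbrs'[of d' u] by (auto simp: st'_def A_def v_def)
  ultimately show thesis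
    using that[OF run] inv' deg' \<delta>(2) by (simp add: st'_def v_def)
qed

text \<open>The pass for \<open>In\<close> puts its pair into the exception set of the invariant;
  once the vertex enters \<open>seen\<close>, both exceptions lapse. The pass for \<open>Out\<close>
  keeps the in-neighbours, hence the in-degree just fixed.\<close>

lemma process_copy:
  assumes inv: "invariant {} st" and j: "j \<in> {1..k}" and i: "i \<in> {1..n}"
    and v: "vx i j \<notin> seen st" and len: "\<And>d. length (deltas st d) \<le> k"
  obtains st' where "process_copy G ch z i j st = Some st'"
    "invariant {} st'" "seen st' = insert (vx i j) (seen st)"
    "\<And>d. deltas st' d = deltas st d @ [deg d (cur st') (vx i j)]"
    "\<And>d. deg d (cur st') (vx i j) \<notin> set (deltas st d)"
    "\<And>d u. u \<in> seen st \<Longrightarrow> deg d (cur st') u = deg d (cur st) u"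
    "budget (33 * (k * n)) st st'"
proof -
  obtain s \<delta> where s: "adjust_degree G ch z i j In st = Some s"
    "invariant {(In, vx i j)} s" "seen s = seen st"
    "deltas s = (deltas st)(In := deltas st In @ [\<delta>])" "\<delta> \<notin> set (deltas st In)"
    "deg In (cur s) (vx i j) = \<delta>"
    "\<And>d' u. u \<in> seen st \<Longrightarrow> nbrs d' (cur s) u = nbrs d' (cur st) u"
    "budget (16 * (k * n)) st s"
    by (rule adjust_degree[OF inv j i v _ len[of In]]) auto
  obtain s' \<delta>' where s': "adjust_degree G ch z i j Out s = Some s'"
    "invariant {(Out, vx i j), (In, vx i j)} s'" "seen s' = seen st"
    "deltas s' = (deltas s)(Out := deltas s Out @ [\<delta>'])" "\<delta>' \<notin> set (deltas s Out)"
    "deg Out (cur s') (vx i j) = \<delta>'"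
    "\<And>d'. d' \<noteq> Out \<Longrightarrow> nbrs d' (cur s') (vx i j) = nbrs d' (cur s) (vx i j)"
    "\<And>d' u. u \<in> seen st \<Longrightarrow> nbrs d' (cur s') u = nbrs d' (cur s) u"
    "budget (16 * (k * n)) s s'"
    using adjust_degree[OF s(2) j i, of Out] v len[of Out] unfolding s(3) by (auto simp: s(4))
  define st' where "st' = s'\<lparr>seen := insert (vx i j) (seen s'), clock := clock s' + 1\<rparr>"
  have deg_In: "deg In (cur s') (vx i j) = \<delta>" using s(6) s'(7)[of In] by (simp add: deg_def)
  show thesis
  proof (rule that)
    show "process_copy G ch z i j st = Some st'"
      by (simp add: process_copy_def s(1) s'(1) st'_def vx_def)
    show "invariant {} st'"
      using s'(2) vx_in_part[OF i, of j] part_subset[OF j] unfolding invariant_def st'_def by auto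
    show "seen st' = insert (vx i j) (seen st)" by (simp add: st'_def s')
    show "deltas st' d = deltas st d @ [deg d (cur st') (vx i j)]" for d
      using s s' deg_In by (cases d) (auto simp: st'_def)
    show "deg d (cur st') (vx i j) \<notin> set (deltas st d)" for d
      using s s' deg_In by (cases d) (auto simp: st'_def)
    show "deg d (cur st') u = deg d (cur st) u" if "u \<in> seen st" for d u
      using s(7)[OF that] s'(8)[OF that] by (simp add: st'_def deg_def)
    have "budget 1 s' st'" by (simp add: budget_def st'_def)
    then have "budget (16 * (k * n) + 16 * (k * n) + 1) st st'"
      using s(8) s'(9) budget_trans by blast
    then show "budget (33 * (k * n)) st st'" by (rule budget_mono) (use le_kn in linarith)
  qed
qed

text \<open>Degrees of vertices in \<open>seen\<close> are frozen, so \<open>deltas\<close> always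
  lists the current degrees of the copies treated so far, and each new degree avoids that
  list.\<close>

lemma process_vertex:
  assumes inv: "invariant {} st" and i: "i \<in> {1..n}" and unseen: "vx i ` {1..k} \<inter> seen st = {}"
  obtains st' where "process_vertex G k ch z i st = Some st'"
    "invariant {} st'" "seen st' = seen st \<union> vx i ` {1..k}"
    "\<And>d. inj_on (\<lambda>j. deg d (cur st') (vx i j)) {1..k}"
    "\<And>d u. u \<in> seen st \<Longrightarrow> deg d (cur st') u = deg d (cur st) u"
    "budget (33 * k * (k * n)) st st'"
proof -
  define s0 where "s0 = st\<lparr>deltas := (\<lambda>d. [deg d (cur st) (vx i 1)]), seen := insert (vx i 1) (seen st),
              clock := clock st + 2 * card (verts (cur st)) + 2 * k + 1\<rparr>"
  \<comment> \<open>Loop invariant before copy \<open>j\<close>; the loop starts at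
    \<open>j = 2\<close>, as copy 1 keeps the degrees found on entry.\<close>
  define P where "P j s \<longleftrightarrow> invariant {} s \<and> seen s = seen st \<union> vx i ` {1..<j} \<and>
    (\<forall>d. deltas s d = map (\<lambda>j. deg d (cur s) (vx i j)) [1..<j] \<and> distinct (deltas s d)) \<and>
    (\<forall>d. \<forall>u\<in>seen st. deg d (cur s) u = deg d (cur st) u) \<and>
    budget (9 * (k * n) + 33 * (k * n) * (j - 2)) st s" for j s
  have "\<exists>s. iterate (process_copy G ch z i) [2..<k + 1] s0 = Some s \<and> P (k + 1) s"
  proof (rule iterate_upt)
    show "2 \<le> k + 1" using k by simp
    \<comment> \<open>At most \<open>3 * (k * n)\<close> vertices exist, so reading two degrees
      costs 6 units of \<open>k * n\<close>; emptying the arrays and the insertion cost 3.\<close>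
    have "2 * card (verts (cur st)) + 2 * k + 1 \<le> 9 * (k * n)" if "news st \<le> 2 * (k * n)"
      using invariant_card_verts[OF inv] le_kn that by linarith
    then have "budget (9 * (k * n)) st s0"
      unfolding budget_def s0_def by simp
    moreover have "invariant {} s0"
      using inv vx_in_part[OF i, of 1] part_subset[of 1] k unfolding invariant_def s0_def by auto
    moreover have "{1..<2} = {1::nat}" "[1..<2] = [1::nat]" by (auto simp: upt_rec)
    ultimately show "P 2 s0" by (simp add: P_def s0_def)
  next
    fix j s assume j: "2 \<le> j" "j < k + 1" and P: "P j s"
    have *: "vx i j \<notin> seen s"
    proof
      assume "vx i j \<in> seen s"
      moreover have "j \<in> {1..k}" using j by simp
      then have "vx i j \<notin> seen st" using unseen by blast
      ultimately obtain j' where "vx i j = vx i j'" "1 \<le> j'" "j' < j" using P by (auto simp: P_def)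
      with vx_inj(2)[OF this(1) i i] j show False by simp
    qed
    obtain s' where s': "process_copy G ch z i j s = Some s'"
      "invariant {} s'" "seen s' = insert (vx i j) (seen s)"
      "\<And>d. deltas s' d = deltas s d @ [deg d (cur s') (vx i j)]"
      "\<And>d. deg d (cur s') (vx i j) \<notin> set (deltas s d)"
      "\<And>d u. u \<in> seen s \<Longrightarrow> deg d (cur s') u = deg d (cur s) u"
      "budget (33 * (k * n)) s s'"
      by (rule process_copy[of s j i]) (use P j i * in \<open>auto simp: P_def\<close>)
    have upt: "[1..<Suc j] = [1..<j] @ [j]" "{1..<Suc j} = insert j {1..<j}" using j by auto
    have "budget (9 * (k * n) + 33 * (k * n) * (j - 2) + 33 * (k * n)) st s'"
      using P s'(7) budget_trans unfolding P_def by blast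
    moreover have "9 * (k * n) + 33 * (k * n) * (j - 2) + 33 * (k * n) =
        9 * (k * n) + 33 * (k * n) * (Suc j - 2)"
      using j by (simp add: Suc_diff_le algebra_simps)
    ultimately have "budget (9 * (k * n) + 33 * (k * n) * (Suc j - 2)) st s'" by simp
    moreover have "deltas s' d = map (\<lambda>j. deg d (cur s') (vx i j)) [1..<Suc j]" for d
      using P s'(4,6) unfolding upt P_def by auto
    moreover have "distinct (deltas s' d)" for d
    proof -
      have "distinct (deltas s d)" using P unfolding P_def by blast
      then show ?thesis using s'(4,5)[of d] by simp
    qed
    moreover have "seen s' = seen st \<union> vx i ` {1..<Suc j}"
      using P unfolding P_def s'(3) upt by blast
    moreover have "deg d (cur s') u = deg d (cur st) u" if "u \<in> seen st" for d u
      using P s'(6)[of u d] that unfolding P_def by simp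
    ultimately have "P (Suc j) s'"
      using s'(2) unfolding P_def by blast
    then show "\<exists>s'. process_copy G ch z i j s = Some s' \<and> P (Suc j) s'" using s'(1) by blast
  qed
  then obtain s where s: "iterate (process_copy G ch z i) [2..<k + 1] s0 = Some s" "P (k + 1) s" by blast
  have k1: "{1..<k + 1} = {1..k}" by auto
  show thesis
  proof (rule that)
    show "process_vertex G k ch z i st = Some s"
      using s(1) by (simp add: process_vertex_def s0_def vx_def)
    show "invariant {} s" "seen s = seen st \<union> vx i ` {1..k}"
      using s(2) unfolding P_def k1 by auto
    show "inj_on (\<lambda>j. deg d (cur s) (vx i j)) {1..k}" for d
    proof -
      have "distinct (map (\<lambda>j. deg d (cur s) (vx i j)) [1..<k + 1])"
        using s(2) unfolding P_def by metis
      then show ?thesis by (simp only: distinct_map set_upt k1)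
    qed
    show "deg d (cur s) u = deg d (cur st) u" if "u \<in> seen st" for d u
      using s(2) that by (simp add: P_def)
    have "budget (9 * (k * n) + 33 * (k * n) * (k + 1 - 2)) st s" using s(2) by (simp only: P_def)
    \<comment> \<open>There are \<open>k - 1\<close> iterations, so the initial 9 units fit into the
      33 of the missing one.\<close>
    moreover have "9 * (k * n) + 33 * (k * n) * (k + 1 - 2) \<le> 33 * k * (k * n)"
      using k by (cases k) (auto simp: algebra_simps)
    ultimately show "budget (33 * k * (k * n)) st s" by (rule budget_mono)
  qed
qed

section \<open>The disjoint union, its links, and all of step 3\<close>

lemma A0_simps: "verts A0 = V0"
  "edges A0 = (\<Union>j\<in>{1..k}. map_prod (copy ch j) (copy ch j) ` edges G)"
  by (auto simp: A0_def disjoint_copies_def V0_def part_def Let_def)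

text \<open>Copies are disjoint and each is injective, so the description operator in
  \<open>disjoint_copies\<close> recovers the original vertex.\<close>

lemma weight_A0:
  assumes "j \<in> {1..k}" "u \<in> verts G" "v \<in> verts G"
  shows "weight A0 (copy ch j u, copy ch j v) = weight G (u, v)"
proof -
  have "(THE v. v \<in> verts G \<and> (\<exists>j\<in>{1..k}. copy ch j v = copy ch j' w)) = w"
    if "j' \<in> {1..k}" "w \<in> verts G" for j' w
    using that copy_inj by (intro the_equality) blast+
  then show ?thesis using assms by (simp add: A0_def disjoint_copies_def Let_def)
qed

lemma edges_A0_copy:
  assumes "j \<in> {1..k}" "u \<in> verts G" "v \<in> verts G"
  shows "(copy ch j u, copy ch j v) \<in> edges A0 \<longleftrightarrow> (u, v) \<in> edges G"
proof
  assume "(copy ch j u, copy ch j v) \<in> edges A0"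
  then obtain j' u' v' where *: "j' \<in> {1..k}" "(u', v') \<in> edges G"
    "copy ch j u = copy ch j' u'" "copy ch j v = copy ch j' v'" by (auto simp: A0_simps)
  then have "u = u'" "v = v'" using copy_inj assms edges_G by blast+
  then show "(u, v) \<in> edges G" using * by simp
qed (use assms in \<open>auto simp: A0_simps intro!: bexI[of _ j] image_eqI[of _ _ "(u, v)"]\<close>)

text \<open>\<open>c\<close> stands for the time already spent in steps 1 and 2.\<close>

definition start :: "nat \<Rightarrow> ('v, 'l) state" where
  "start c = \<lparr>cur = A0\<lparr>edges := edges A0 \<union> link ch ` {1..<k}\<rparr>, seen = {}, deltas = (\<lambda>_. []),
     news = 0, clock = c\<rparr>"

text \<open>A link joins two different copies, so it lies inside no \<open>part j\<close>. Nothing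
  has been created yet, hence all neighbours lie in \<open>V0\<close>.\<close>

lemma invariant_start: "invariant {} (start c)"
proof -
  have link: "link ch j \<in> part j \<times> part (j + 1) \<union> part (j + 1) \<times> part j" if "j \<in> {1..<k}" for j
    using valid that by (auto simp: valid_choices_def part_def)
  have A0: "edges A0 \<subseteq> V0 \<times> V0" using edges_G by (force simp: A0_simps V0_def part_def)
  have "link ch ` {1..<k} \<subseteq> V0 \<times> V0"
  proof
    fix e assume "e \<in> link ch ` {1..<k}"
    then obtain j where j: "j \<in> {1..<k}" "e = link ch j" by blast
    have "part j \<subseteq> V0" "part (j + 1) \<subseteq> V0" using j by (auto intro!: part_subset)
    then show "e \<in> V0 \<times> V0" using link[OF j(1)] unfolding j(2) by (auto simp: mem_Times_iff)
  qed
  then have E: "edges A0 \<union> link ch ` {1..<k} \<subseteq> V0 \<times> V0" using A0 by blast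
  have "link ch j' \<notin> part j \<times> part j" if "j \<in> {1..k}" "j' \<in> {1..<k}" for j j'
  proof -
    have "part j' \<inter> part (j' + 1) = {}" using that by (intro part_disjoint) auto
    moreover have "part j' \<inter> part j = {} \<or> j' = j" using that by (intro disjCI part_disjoint) auto
    ultimately show ?thesis using link[OF that(2)] by (auto simp: mem_Times_iff)
  qed
  then have "link ch ` {1..<k} \<inter> part j \<times> part j = {}" if "j \<in> {1..k}" for j
    using that by (intro equals0I) (elim IntE imageE, simp)
  then have "(edges A0 \<union> link ch ` {1..<k}) \<inter> part j \<times> part j \<subseteq> edges A0" if "j \<in> {1..k}" for j
    using that by (simp add: Int_Un_distrib2)
  moreover have "nbrs d (cur (start c)) u \<subseteq> V0" for d u
    using E by (cases d) (auto simp: start_def)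
  ultimately show ?thesis using E unfolding invariant_def start_def by (auto simp: A0_simps)
qed

text \<open>All copies of the \<open>i\<close>-th vertex are in \<open>seen\<close> after round
  \<open>i\<close>, so the distinctness of their degrees survives later rounds. The \<open>n\<close>
  rounds of cost \<open>33 * k * (k * n)\<close> add up to the square.\<close>

lemma run:
  obtains st where "iterate (process_vertex G k ch z) [1..<n + 1] (start c) = Some st"
    "invariant {} st" "\<And>v d. v \<in> verts G \<Longrightarrow> inj_on (\<lambda>j. deg d (cur st) (copy ch j v)) {1..k}"
    "budget (33 * (k * n)\<^sup>2) (start c) st"
proof -
  define Q where "Q i s \<longleftrightarrow> invariant {} s \<and> seen s = (\<Union>i'\<in>{1..<i}. vx i' ` {1..k}) \<and>
    (\<forall>i'\<in>{1..<i}. \<forall>d. inj_on (\<lambda>j. deg d (cur s) (vx i' j)) {1..k}) \<and>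
    budget ((i - 1) * (33 * k * (k * n))) (start c) s" for i s
  have "\<exists>s. iterate (process_vertex G k ch z) [1..<n + 1] (start c) = Some s \<and> Q (n + 1) s"
  proof (rule iterate_upt)
    show "Q 1 (start c)" using invariant_start[of c] budget_refl by (simp add: Q_def start_def)
  next
    fix i s assume i: "1 \<le> i" "i < n + 1" and Q: "Q i s"
    have i': "i \<in> {1..n}" using i by simp
    have "vx i ` {1..k} \<inter> seen s = {}"
    proof (rule ccontr)
      assume "vx i ` {1..k} \<inter> seen s \<noteq> {}"
      then obtain j i' j' where "vx i j = vx i' j'" "j \<in> {1..k}" "j' \<in> {1..k}" "i' \<in> {1..<i}"
        using Q unfolding Q_def by blast
      then show False using vx_inj(1)[of i j i' j'] i by auto
    qed
    then obtain s' where s': "process_vertex G k ch z i s = Some s'"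
      "invariant {} s'" "seen s' = seen s \<union> vx i ` {1..k}"
      "\<And>d. inj_on (\<lambda>j. deg d (cur s') (vx i j)) {1..k}"
      "\<And>d u. u \<in> seen s \<Longrightarrow> deg d (cur s') u = deg d (cur s) u"
      "budget (33 * k * (k * n)) s s'"
      using process_vertex[of s i] Q i' unfolding Q_def by metis
    have upt: "{1..<Suc i} = insert i {1..<i}" using i by auto
    have old: "inj_on (\<lambda>j. deg d (cur s') (vx i' j)) {1..k}" if "i' \<in> {1..<i}" for i' d
    proof -
      have eq: "deg d (cur s') (vx i' j) = deg d (cur s) (vx i' j)" if "j \<in> {1..k}" for j
      proof (rule s'(5))
        show "vx i' j \<in> seen s" using Q \<open>i' \<in> {1..<i}\<close> that unfolding Q_def by blast
      qed
      have "inj_on (\<lambda>j. deg d (cur s) (vx i' j)) {1..k}" using Q that unfolding Q_def by blast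
      then show ?thesis by (subst inj_on_cong[OF eq])
    qed
    have "budget ((i - 1) * (33 * k * (k * n)) + 33 * k * (k * n)) (start c) s'"
      using Q s'(6) budget_trans unfolding Q_def by blast
    moreover have "(i - 1) * (33 * k * (k * n)) + 33 * k * (k * n) = (Suc i - 1) * (33 * k * (k * n))"
      using i by (cases i) auto
    ultimately have "budget ((Suc i - 1) * (33 * k * (k * n))) (start c) s'" by simp
    moreover have "seen s' = (\<Union>i'\<in>{1..<Suc i}. vx i' ` {1..k})"
      using Q unfolding Q_def s'(3) upt by (simp add: Un_commute)
    moreover have "\<forall>i'\<in>{1..<Suc i}. \<forall>d. inj_on (\<lambda>j. deg d (cur s') (vx i' j)) {1..k}"
      unfolding upt using s'(4) old by auto
    ultimately have "Q (Suc i) s'"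
      using s'(2) unfolding Q_def by (intro conjI)
    then show "\<exists>s'. process_vertex G k ch z i s = Some s' \<and> Q (Suc i) s'" using s'(1) by blast
  qed simp
  then obtain s where s: "iterate (process_vertex G k ch z) [1..<n + 1] (start c) = Some s" "Q (n + 1) s"
    by blast
  show thesis
  proof (rule that[OF s(1)])
    show "invariant {} s" using s(2) by (simp add: Q_def)
    have "budget ((n + 1 - 1) * (33 * k * (k * n))) (start c) s" using s(2) by (simp only: Q_def)
    moreover have "(n + 1 - 1) * (33 * k * (k * n)) = 33 * (k * n)\<^sup>2" by (simp add: power2_eq_square)
    ultimately show "budget (33 * (k * n)\<^sup>2) (start c) s" by (simp only:)
    fix v d assume "v \<in> verts G"
    then obtain m where m: "m < n" "vertex_list ch ! m = v" using vertex_list by (metis in_set_conv_nth)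
    then have "inj_on (\<lambda>j. deg d (cur s) (vx (m + 1) j)) {1..k}"
      using s(2) unfolding Q_def by simp
    then show "inj_on (\<lambda>j. deg d (cur s) (copy ch j v)) {1..k}" using m by (simp add: vx_def)
  qed
qed

end

section \<open>The output and the running time\<close>

text \<open>Makes the index set of the degree draws countable, so that their almost sure properties
  can be combined.\<close>

instance dir :: countable by countable_datatype

text \<open>As \<open>P\<close> is an arbitrary predicate, its exceptional set is first enlarged to
  a measurable null set \<open>S\<close>; the product of \<open>S\<close> with the whole second
  factor is null.\<close>

lemma AE_pair_fst:
  assumes "sigma_finite_measure N" "AE x in M. P x"
  shows "AE w in M \<Otimes>\<^sub>M N. P (fst w)"
proof -
  interpret sigma_finite_measure N by fact
  obtain S where S: "{x \<in> space M. \<not> P x} \<subseteq> S" "emeasure M S = 0" "S \<in> sets M"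
    using AE_E[OF assms(2)] .
  then have "S \<times> space N \<in> null_sets (M \<Otimes>\<^sub>M N)"
    by (auto simp: null_sets_def emeasure_pair_measure_Times)
  then show ?thesis by (rule AE_I') (use S in \<open>auto simp: space_pair_measure\<close>)
qed

lemma AE_pair_snd:
  assumes "sigma_finite_measure N" "AE y in N. P y"
  shows "AE w in M \<Otimes>\<^sub>M N. P (snd w)"
proof -
  interpret sigma_finite_measure N by fact
  obtain S where S: "{y \<in> space N. \<not> P y} \<subseteq> S" "emeasure N S = 0" "S \<in> sets N"
    using AE_E[OF assms(2)] .
  then have "space M \<times> S \<in> null_sets (M \<Otimes>\<^sub>M N)"
    by (auto simp: null_sets_def emeasure_pair_measure_Times)
  then show ?thesis by (rule AE_I') (use S in \<open>auto simp: space_pair_measure\<close>)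
qed

text \<open>All that is used of the randomness; the leading 1 in the index of a weight means step 1.
  No choices are mentioned, so one null set serves all of them.\<close>

definition good_sample ::
  "('v, 'l) graph \<Rightarrow> nat \<Rightarrow> (dir \<Rightarrow> nat pmf) \<Rightarrow> 'v sample \<Rightarrow> bool" where
  "good_sample G M p s \<longleftrightarrow> (\<forall>q. fst s q \<in> {0..1}) \<and>
     (\<forall>i\<in>{1..M}. \<forall>e\<in>edges G. fst s (1, i, e) \<noteq> weight G e) \<and>
     (\<forall>q. snd s q \<in> set_pmf (p (fst q)))"

lemma AE_good_sample:
  fixes G :: "('v, 'l) graph"
  assumes "klone_input G \<Sigma> k Qs LA M p\<omega>"
  shows "AE s in klone_space p\<omega> p. good_sample G M p s"
proof -
  let ?M1 = "(\<Pi>\<^sub>M _\<in>UNIV. p\<omega>) :: (nat \<times> nat \<times> 'v \<times> 'v \<Rightarrow> real) measure"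
  let ?M2 = "(\<Pi>\<^sub>M q\<in>UNIV. measure_pmf (p (fst q))) :: (dir \<times> nat \<times> nat \<times> nat \<Rightarrow> nat) measure"
  have wf: "wf_graph G" and prob: "prob_space p\<omega>" and sets: "sets p\<omega> = sets (restrict_space borel {0..1})"
    and null: "\<And>e. e \<in> edges G \<Longrightarrow> measure p\<omega> {weight G e} = 0"
    using assms by (auto simp: klone_input_def knowledge_graph_def)
  interpret P: prob_space p\<omega> by (fact prob)
  have space: "space p\<omega> = {0..1}" using sets_eq_imp_space_eq[OF sets] by (simp add: space_restrict_space)
  have sf: "sigma_finite_measure ?M2"
    by (intro prob_space_imp_sigma_finite prob_space_PiM prob_space_measure_pmf)
  have fin: "finite (edges G)"
    using wf finite_subset[of "edges G" "verts G \<times> verts G"] by (auto simp: wf_graph_def)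
  have "AE f in ?M1. \<forall>q. f q \<in> {0..1}"
    by (rule AE_I2) (auto simp: space_PiM space PiE_def Pi_def)
  moreover have "AE f in ?M1. \<forall>i\<in>{1..M}. \<forall>e\<in>edges G. f (1, i, e) \<noteq> weight G e"
  proof (intro eventually_ball_finite ballI fin finite_atLeastAtMost)
    fix i e assume e: "e \<in> edges G"
    have w: "weight G e \<in> {0..1}" using wf e by (auto simp: wf_graph_def)
    \<comment> \<open>The weight lies in the unit interval, so its singleton is measurable for
      \<open>p\<omega>\<close>, which lives on that interval.\<close>
    have "{weight G e} \<in> sets p\<omega>"
      unfolding sets using w by (intro sets_restrict_space_iff[THEN iffD2]) auto
    then have "{weight G e} \<in> null_sets p\<omega>"
      using null[OF e] by (simp add: null_sets_def P.emeasure_eq_measure)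
    then have "AE w in p\<omega>. w \<noteq> weight G e" by (rule AE_I') auto
    then show "AE f in ?M1. f (1, i, e) \<noteq> weight G e"
      by (intro AE_PiM_component) (auto intro: prob)
  qed
  ultimately have "AE f in ?M1. (\<forall>q. f q \<in> {0..1}) \<and>
      (\<forall>i\<in>{1..M}. \<forall>e\<in>edges G. f (1, i, e) \<noteq> weight G e)" by eventually_elim blast
  from AE_pair_fst[OF sf this]
  have 1: "AE s in klone_space p\<omega> p. (\<forall>q. fst s q \<in> {0..1}) \<and>
      (\<forall>i\<in>{1..M}. \<forall>e\<in>edges G. fst s (1, i, e) \<noteq> weight G e)" unfolding klone_space_def .
  have "AE f in ?M2. \<forall>q. f q \<in> set_pmf (p (fst q))"
    unfolding AE_all_countable
    by (intro allI AE_PiM_component AE_measure_pmf prob_space_measure_pmf UNIV_I)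
  from AE_pair_snd[OF sf this]
  have 2: "AE s in klone_space p\<omega> p. \<forall>q. snd s q \<in> set_pmf (p (fst q))" unfolding klone_space_def .
  from 1 2 show ?thesis by eventually_elim (simp add: good_sample_def)
qed

text \<open>Any copy may win: the sequel uses only that the winner is one of the \<open>M\<close>
  reweightings. Reweighting keeps the vertices, so all \<open>M\<close> copies obey the same time
  bound.\<close>

lemma weight_noising_result:
  assumes M: "1 \<le> M" and pick: "\<forall>us. us \<noteq> [] \<longrightarrow> pick us < length us"
  obtains i t where "i \<in> {1..M}"
    "weight_noising A G \<Sigma> S Qs M tU pick z = (reweight A S (z i), t)"
    "\<forall>c. (\<forall>H B. tU H B \<le> c) \<longrightarrow> t \<le> M * ((card (verts A))\<^sup>2 + 2 * card S + c + 1)"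
proof -
  define As where "As = map (\<lambda>i. reweight A S (z i)) [1..<M + 1]"
  define t where "t = (\<Sum>B\<leftarrow>As. (card (verts B))\<^sup>2 + 2 * card S + tU G B + 1)"
  have len: "length As = M" by (simp add: As_def)
  define m where "m = pick (map (utility G \<Sigma> Qs) As)"
  have "As \<noteq> []" using len M by auto
  then have m: "m < M" using pick[THEN spec, of "map (utility G \<Sigma> Qs) As"] by (simp add: m_def len)
  have verts: "verts B = verts A" if "B \<in> set As" for B
    using that by (auto simp: As_def reweight_def)
  show thesis
  proof (rule that)
    \<comment> \<open>List positions start at 0, while copies are numbered from 1.\<close>
    show "m + 1 \<in> {1..M}" using m by simp
    have "As ! m = reweight A S (z (m + 1))" unfolding As_def using m by (subst nth_map_upt) auto
    then show "weight_noising A G \<Sigma> S Qs M tU pick z = (reweight A S (z (m + 1)), t)"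
      unfolding weight_noising_def Let_def As_def[symmetric] m_def[symmetric] t_def by simp
    have "t \<le> M * ((card (verts A))\<^sup>2 + 2 * card S + c + 1)" if c: "\<forall>H B. tU H B \<le> c" for c
    proof -
      have "t \<le> (\<Sum>B\<leftarrow>As. (card (verts A))\<^sup>2 + 2 * card S + c + 1)"
        unfolding t_def by (rule sum_list_mono) (use c verts in auto)
      also have "\<dots> = M * ((card (verts A))\<^sup>2 + 2 * card S + c + 1)"
        by (simp only: map_replicate_const sum_list_replicate len of_nat_id)
      finally show ?thesis .
    qed
    then show "\<forall>c. (\<forall>H B. tU H B \<le> c) \<longrightarrow> t \<le> M * ((card (verts A))\<^sup>2 + 2 * card S + c + 1)"
      by blast
  qed
qed

section \<open>The copies of an induced subgraph\<close>

context klone_run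
begin

text \<open>The witnesses are the copies of \<open>X1\<close>. By the invariant, edges inside a copy
  are copies of edges of \<open>G\<close>, and their weights are still those of \<open>A0\<close>,
  so all copies carry equal weights.\<close>

lemma subgraph_copies:
  assumes inv: "invariant {} st"
    and deg: "\<And>v d. v \<in> verts G \<Longrightarrow> inj_on (\<lambda>j. deg d (cur st) (copy ch j v)) {1..k}"
    and A: "verts A = verts (cur st)" "edges A = edges (cur st)"
      "\<And>e. e \<in> edges A0 \<Longrightarrow> weight A e = weight A0 e"
    and lab: "inj_on (label A) (verts A)" "label A ` verts A \<subseteq> LA"
    and rules: "\<And>\<sigma>. \<sigma> \<in> \<Sigma> \<Longrightarrow> rule_consts \<sigma> \<inter> (range VertexC \<union> LabelC ` LA) = {}"
    and X1: "X1 \<subseteq> verts G"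
  shows "\<exists>X \<Psi>. X 1 = X1 \<and> (\<forall>i\<in>{1..k}. X i \<subseteq> verts A) \<and>
           (\<forall>i\<in>{1..k}. \<forall>j\<in>{1..k}. i \<noteq> j \<longrightarrow> X i \<inter> X j = {}) \<and>
           (\<forall>i\<in>{1..k}. chase_isomorphism \<Sigma> (induced A X1) (induced A (X i)) (\<Psi> i)) \<and>
           (\<forall>v\<in>X1. on_verts (\<Psi> 1) v = v) \<and>
           (\<forall>v\<in>X1. \<forall>i\<in>{1..k}. \<forall>j\<in>{1..k}. i \<noteq> j \<longrightarrow>
              attrs_differ A (on_verts (\<Psi> i) v) (on_verts (\<Psi> j) v))"
proof -
  have part_A: "copy ch j v \<in> verts A" if "j \<in> {1..k}" "v \<in> verts G" for j v
    using that inv by (auto simp: A invariant_def V0_def part_def)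
  have X1_A: "X1 \<subseteq> verts A" using part_A[of 1] copy_1 X1 k by auto
  have edges: "(copy ch j u, copy ch j v) \<in> edges A \<longleftrightarrow> (u, v) \<in> edges G"
    if "j \<in> {1..k}" "u \<in> verts G" "v \<in> verts G" for j u v
  proof -
    have "(copy ch j u, copy ch j v) \<in> part j \<times> part j" using that by (auto simp: part_def)
    moreover have "edges (cur st) \<inter> part j \<times> part j \<subseteq> edges A0" "edges A0 \<subseteq> edges (cur st)"
      using inv that(1) unfolding invariant_def by blast+
    ultimately have "(copy ch j u, copy ch j v) \<in> edges A \<longleftrightarrow> (copy ch j u, copy ch j v) \<in> edges A0"
      unfolding A by blast
    then show ?thesis using edges_A0_copy[OF that] by simp
  qed
  have weight: "weight A (copy ch j u, copy ch j v) = weight G (u, v)"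
    if "j \<in> {1..k}" "(u, v) \<in> edges G" for j u v
  proof -
    have "u \<in> verts G" "v \<in> verts G" using that edges_G by auto
    then show ?thesis using A(3) edges_A0_copy weight_A0 that by simp
  qed
  have one: "1 \<in> {1..k}" using k by simp
  have "\<exists>\<Psi>. chase_isomorphism \<Sigma> (induced A X1) (induced A (copy ch j ` X1)) \<Psi> \<and>
      (\<forall>v\<in>X1. on_verts \<Psi> v = copy ch j v)" if j: "j \<in> {1..k}" for j
  proof -
    have "finite X1" using X1 fin finite_subset by blast
    moreover have "copy ch j ` X1 \<subseteq> verts A" using part_A j X1 by auto
    moreover have "inj_on (copy ch j) X1" using copy_inj(2)[OF _ j j] X1 by (auto simp: inj_on_def)
    moreover have "(copy ch j u, copy ch j v) \<in> edges A \<longleftrightarrow> (u, v) \<in> edges A"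
      if "u \<in> X1" "v \<in> X1" for u v
      using edges[OF j, of u v] edges[OF one, of u v] that X1 copy_1 by auto
    moreover have "weight A (copy ch j u, copy ch j v) = weight A (u, v)"
      if uv: "u \<in> X1" "v \<in> X1" "(u, v) \<in> edges A" for u v
    proof -
      have "(u, v) \<in> edges G" using edges[OF one, of u v] uv X1 copy_1 by auto
      moreover have "copy ch 1 u = u" "copy ch 1 v = v" using uv X1 copy_1 by auto
      ultimately show ?thesis using weight[OF j, of u v] weight[OF one, of u v] by simp
    qed
    moreover have "rule_consts \<sigma> \<inter> (range VertexC \<union> LabelC ` label A ` verts A) = {}" if "\<sigma> \<in> \<Sigma>" for \<sigma>
      using rules[OF that] lab(2) by blast
    ultimately show ?thesis
      by (rule chase_isomorphism_induced[OF _ X1_A _ _ lab(1), of "copy ch j" \<Sigma>]) blast+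
  qed
  then obtain \<Psi> where \<Psi>: "\<And>j. j \<in> {1..k} \<Longrightarrow>
      chase_isomorphism \<Sigma> (induced A X1) (induced A (copy ch j ` X1)) (\<Psi> j)"
    "\<And>j v. j \<in> {1..k} \<Longrightarrow> v \<in> X1 \<Longrightarrow> on_verts (\<Psi> j) v = copy ch j v" by metis
  have differ: "attrs_differ A (copy ch i v) (copy ch j v)"
    if "v \<in> X1" "i \<in> {1..k}" "j \<in> {1..k}" "i \<noteq> j" for v i j
  proof -
    have v: "v \<in> verts G" using that X1 by blast
    have "deg d A (copy ch i v) \<noteq> deg d A (copy ch j v)" for d
    proof -
      have "nbrs d A u = nbrs d (cur st) u" for u by (cases d) (auto simp: A)
      then show ?thesis using inj_onD[OF deg[OF v, of d], of i j] that by (auto simp: deg_def)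
    qed
    moreover have "label A (copy ch i v) \<noteq> label A (copy ch j v)"
      using inj_onD[OF lab(1)] part_A v copy_inj(1) that by metis
    ultimately show ?thesis by (simp add: attrs_differ_def)
  qed
  show ?thesis
  proof (rule exI[of _ "\<lambda>j. copy ch j ` X1"], rule exI[of _ \<Psi>], intro conjI ballI impI)
    have "copy ch 1 ` X1 = (\<lambda>v. v) ` X1" by (rule image_cong[OF refl]) (use copy_1 X1 in blast)
    then show "copy ch 1 ` X1 = X1" by simp
    show "copy ch i ` X1 \<subseteq> verts A" if "i \<in> {1..k}" for i using part_A that X1 by auto
    show "copy ch i ` X1 \<inter> copy ch j ` X1 = {}" if "i \<in> {1..k}" "j \<in> {1..k}" "i \<noteq> j" for i j
      using part_disjoint[OF that] X1 unfolding part_def by blast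
    show "on_verts (\<Psi> 1) v = v" if "v \<in> X1" for v using \<Psi>(2)[OF one that] copy_1 X1 that by auto
  qed (use \<Psi> differ in auto)
qed

end

section \<open>Combining the steps\<close>

text \<open>Randomness enters only through \<open>good_sample\<close> and, for the time, a bound on
  the degree draws, so one fixed sample and one fixed resolution of the choices can be
  analysed.\<close>

lemma klone_result:
  fixes G :: "('v, 'l) graph"
  assumes input: "klone_input G \<Sigma> k Qs LA M p\<omega>" and good: "good_sample G M p s"
    and valid: "valid_choices G k LA ch"
  obtains A t where "klone G \<Sigma> k Qs LA M tU ch s = Some (A, t)"
    "labels_suffice LA (verts A) \<longrightarrow> (\<forall>x. chase_anonymisation k x G \<Sigma> A)"
    "\<forall>c. (\<forall>H A. tU H A \<le> c) \<and> (\<forall>q. snd s q \<le> card (verts G)) \<longrightarrow>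
       t \<le> (91 + 2 * c) * (M * k\<^sup>2 * (card (verts G))\<^sup>2)"
proof -
  have wfG: "wf_graph G" and k: "1 \<le> k" and M: "1 \<le> M" and nonempty: "verts G \<noteq> {}"
    and LA: "LA \<inter> labels G = {}"
    and rules: "\<And>\<sigma>. \<sigma> \<in> \<Sigma> \<Longrightarrow> rule_consts \<sigma> \<inter> (range VertexC \<union> LabelC ` LA) = {}"
    using input by (auto simp: klone_input_def knowledge_graph_def weakly_connected_def)
  have unit: "fst s q \<in> {0..1}" for q
    using good unfolding good_sample_def by blast
  have pick: "\<forall>us. us \<noteq> [] \<longrightarrow> best ch q us < length us" for q
    using valid by (auto simp: valid_choices_def)
  obtain i1 t1 where i1: "i1 \<in> {1..M}"
    "weight_noising G G \<Sigma> (edges G) Qs M tU (best ch 1) (\<lambda>i e. fst s (1, i, e)) =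
      (reweight G (edges G) (\<lambda>e. fst s (1, i1, e)), t1)"
    "\<forall>c. (\<forall>H B. tU H B \<le> c) \<longrightarrow> t1 \<le> M * ((card (verts G))\<^sup>2 + 2 * card (edges G) + c + 1)"
    by (rule weight_noising_result[OF M pick[of 1], where A = G and G = G and \<Sigma> = \<Sigma> and S = "edges G"
          and Qs = Qs and tU = tU and z = "\<lambda>i e. fst s (1, i, e)"]) (rule that)
  define G' where "G' = reweight G (edges G) (\<lambda>e. fst s (1, i1, e))"
  have G': "verts G' = verts G" "edges G' = edges G" "labels G' = labels G" "label G' = label G"
    "\<And>e. e \<in> edges G \<Longrightarrow> weight G' e = fst s (1, i1, e)"
    by (auto simp: G'_def reweight_def)
  \<comment> \<open>Steps 2 and 3 act on the graph returned by step 1; it differs from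
    \<open>G\<close> only in weights, so valid choices stay valid.\<close>
  interpret klone_run G' k LA ch "snd s"
  proof
    show "wf_graph G'" using wfG unit by (auto simp: wf_graph_def G')
  qed (use nonempty k valid in \<open>auto simp: G' valid_choices_def\<close>)
  define c0 where "c0 = t1 + (card (verts A0))\<^sup>2 + (k - 1)"
  obtain st where st: "iterate (process_vertex G' k ch (snd s)) [1..<n + 1] (start c0) = Some st"
    "invariant {} st" "\<And>v d. v \<in> verts G' \<Longrightarrow> inj_on (\<lambda>j. deg d (cur st) (copy ch j v)) {1..k}"
    "budget (33 * (k * n)\<^sup>2) (start c0) st"
    using run[of c0] by metis
  define B where "B = cur st"
  define S where "S = edges B - edges A0"
  define B' where "B' = B\<lparr>labels := LA, label := relabel ch (verts B)\<rparr>"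
  obtain i4 t4 where i4: "i4 \<in> {1..M}"
    "weight_noising B' G' \<Sigma> S Qs M tU (best ch 4) (\<lambda>i e. fst s (4, i, e)) =
      (reweight B' S (\<lambda>e. fst s (4, i4, e)), t4)"
    "\<forall>c. (\<forall>H B. tU H B \<le> c) \<longrightarrow> t4 \<le> M * ((card (verts B'))\<^sup>2 + 2 * card S + c + 1)"
    by (rule weight_noising_result[OF M pick[of 4], where A = B' and G = G' and \<Sigma> = \<Sigma> and S = S
          and Qs = Qs and tU = tU and z = "\<lambda>i e. fst s (4, i, e)"]) (rule that)
  define A where "A = reweight B' S (\<lambda>e. fst s (4, i4, e))"
  define t where "t = clock st + (card (verts B))\<^sup>2 + card (verts B) + t4"
  have run: "klone G \<Sigma> k Qs LA M tU ch s = Some (A, t)"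
    unfolding klone_def Let_def i1(2)[folded G'_def] case_prod_conv
    unfolding A0_def[symmetric] c0_def[symmetric] start_def[symmetric] G'(1)[symmetric] st(1)
      Option.bind_lunit B_def[symmetric] S_def[symmetric] B'_def[symmetric] i4(2) case_prod_conv
    by (simp add: A_def t_def)
  have A: "verts A = verts B" "edges A = edges B" "labels A = LA" "label A = relabel ch (verts B)"
    "\<And>e. e \<in> S \<Longrightarrow> weight A e = fst s (4, i4, e)" "\<And>e. e \<notin> S \<Longrightarrow> weight A e = weight A0 e"
    using st(2) by (auto simp: A_def B'_def reweight_def B_def invariant_def)
  have B: "verts G \<subseteq> verts B" "edges A0 \<subseteq> edges B" "edges B \<subseteq> verts B \<times> verts B"
  proof -
    have "verts G \<subseteq> V0" using copy_1 k by (force simp: V0_def part_def G')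
    then show "verts G \<subseteq> verts B" using st(2) unfolding invariant_def B_def by blast
    show "edges A0 \<subseteq> edges B" "edges B \<subseteq> verts B \<times> verts B"
      using st(2) unfolding invariant_def B_def by blast+
  qed
  have card_B: "finite (verts B)" "card (verts B) = k * n + news st"
    using invariant_card_verts[OF st(2)] by (auto simp: B_def)
  \<comment> \<open>\<open>G\<close> is its own first copy, so its edges carry in \<open>A0\<close>
    the weights drawn in step 1.\<close>
  have G_A0: "e \<in> edges A0" "weight A0 e = fst s (1, i1, e)" if "e \<in> edges G" for e
  proof -
    obtain u v where e: "e = (u, v)" by (cases e)
    have uv: "u \<in> verts G'" "v \<in> verts G'" using that wfG by (auto simp: e wf_graph_def G')
    then have "copy ch 1 u = u" "copy ch 1 v = v" using copy_1 by auto
    then show "e \<in> edges A0" "weight A0 e = fst s (1, i1, e)"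
      using edges_A0_copy[of 1 u v] weight_A0[of 1 u v] uv k that by (auto simp: e G')
  qed
  have "chase_anonymisation k x G \<Sigma> A" if "labels_suffice LA (verts A)" for x
  proof -
    have lab: "inj_on (label A) (verts A)" "label A ` verts A \<subseteq> LA"
      using valid that card_B(1) unfolding valid_choices_def A by blast+
    have "weight A e \<in> {0..1}" if "e \<in> edges A" for e
    proof (cases "e \<in> S")
      case True
      then show ?thesis using A(5) unit by metis
    next
      case False
      then have "e \<in> edges A0" using that by (auto simp: A S_def)
      then obtain j u v where e: "j \<in> {1..k}" "e = (copy ch j u, copy ch j v)" "(u, v) \<in> edges G'"
        by (auto simp: A0_simps)
      then have "u \<in> verts G'" "v \<in> verts G'" using edges_G by auto
      then have "weight A e = weight G' (u, v)" using A(6)[OF False] e weight_A0 by simp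
      then show ?thesis using G'(2,5) e(3) unit by metis
    qed
    then have "wf_graph A" using card_B(1) B lab(2) by (auto simp: wf_graph_def A)
    then have "knowledge_graph A \<Sigma>" using input by (simp add: knowledge_graph_def klone_input_def)
    moreover have "weight A e \<noteq> weight G e" if "e \<in> edges G" for e
    proof -
      \<comment> \<open>An edge of \<open>G\<close> lies outside \<open>S\<close>, so step 4
        preserves the step 1 draw, which a good sample keeps away from the old weight.\<close>
      have "weight A e = fst s (1, i1, e)" using G_A0[OF that] A(6)[of e] by (simp add: S_def)
      then show ?thesis using good i1(1) that unfolding good_sample_def by simp
    qed
    moreover have "edges G \<subseteq> edges A" using G_A0(1) B(2) by (auto simp: A)
    moreover have "weight A e = weight A0 e" if "e \<in> edges A0" for e
      using A(6)[of e] that by (simp add: S_def)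
    then have "\<forall>X1\<subseteq>verts G'. \<exists>X \<Psi>. X 1 = X1 \<and> (\<forall>i\<in>{1..k}. X i \<subseteq> verts A) \<and>
           (\<forall>i\<in>{1..k}. \<forall>j\<in>{1..k}. i \<noteq> j \<longrightarrow> X i \<inter> X j = {}) \<and>
           (\<forall>i\<in>{1..k}. chase_isomorphism \<Sigma> (induced A X1) (induced A (X i)) (\<Psi> i)) \<and>
           (\<forall>v\<in>X1. on_verts (\<Psi> 1) v = v) \<and>
           (\<forall>v\<in>X1. \<forall>i\<in>{1..k}. \<forall>j\<in>{1..k}. i \<noteq> j \<longrightarrow>
              attrs_differ A (on_verts (\<Psi> i) v) (on_verts (\<Psi> j) v))"
      using subgraph_copies[OF st(2,3) A(1,2)[unfolded B_def] _ lab rules] by blast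
    ultimately show ?thesis
      unfolding chase_anonymisation_def using LA B(1) by (auto simp: A(1,3) G')
  qed
  moreover have "t \<le> (91 + 2 * c) * (M * k\<^sup>2 * (card (verts G))\<^sup>2)"
    if c: "\<forall>H A. tU H A \<le> c" and z: "\<forall>q. snd s q \<le> card (verts G)" for c
  proof -
    define U where "U = k * n"
    define W where "W = U\<^sup>2"
    have U: "1 \<le> U" "k \<le> U" "n \<le> U" using le_kn by (auto simp: U_def)
    have W: "U \<le> W" using U by (simp add: W_def power2_eq_square)
    \<comment> \<open>\<open>start\<close> has \<open>news = 0\<close>, so the account of the whole
      step 3 is settled by the final \<open>news st\<close> alone.\<close>
    have news: "news st \<le> 2 * U" and clock: "clock st \<le> c0 + 33 * W + 6 * U * news st"
      using st(4) z by (simp_all add: budget_def start_def G' U_def W_def)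
    have "6 * U * news st \<le> 6 * U * (2 * U)" using news by (intro mult_le_mono2)
    moreover have "6 * U * (2 * U) = 12 * W" by (simp add: W_def power2_eq_square)
    ultimately have clock: "clock st \<le> c0 + 45 * W" using clock by linarith
    have "n\<^sup>2 \<le> W" unfolding W_def using U by (intro power_mono) auto
    have cB: "card (verts B) \<le> 3 * U" using card_B news by (simp add: U_def)
    then have "(card (verts B))\<^sup>2 \<le> (3 * U)\<^sup>2" by (intro power_mono) auto
    then have cB2: "(card (verts B))\<^sup>2 \<le> 9 * W" by (simp add: W_def power_mult_distrib)
    have "card S \<le> card (verts B \<times> verts B)"
      using B(3) card_B(1) by (intro card_mono) (auto simp: S_def)
    then have cS: "card S \<le> 9 * W" using cB2 by (simp add: card_cartesian_product power2_eq_square)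
    have "card (edges G) \<le> card (verts G \<times> verts G)"
      using wfG by (intro card_mono) (auto simp: wf_graph_def)
    then have cE: "card (edges G) \<le> W"
      using \<open>n\<^sup>2 \<le> W\<close> by (simp add: card_cartesian_product power2_eq_square G')
    have "1 \<le> W" using U W by simp
    then have c1: "c + 1 \<le> (c + 1) * W" using mult_le_mono2[of 1 W "c + 1"] by (simp only: mult_1_right)
    have "t1 \<le> M * (3 * W + (c + 1) * W)"
      by (rule order_trans[OF i1(3)[THEN spec, THEN mp, OF c]], rule mult_le_mono2)
        (use cE \<open>n\<^sup>2 \<le> W\<close> c1 in \<open>simp add: G'\<close>)
    moreover have "t4 \<le> M * (27 * W + (c + 1) * W)"
      by (rule order_trans[OF i4(3)[THEN spec, THEN mp, OF c]], rule mult_le_mono2)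
        (use cB2 cS c1 in \<open>simp add: B'_def\<close>)
    moreover have "c0 \<le> t1 + W + U"
      using U(2) by (simp add: c0_def A0_simps card_V0 W_def U_def[symmetric])
    moreover have "W \<le> M * W" using M by simp
    \<comment> \<open>The middle 59 collects 45 from step 3, 2 from the union and its links, and 9
      and 3 from scanning and relabelling.\<close>
    ultimately have "t \<le> M * (3 * W + (c + 1) * W) + 59 * (M * W) + M * (27 * W + (c + 1) * W)"
      using clock cB cB2 W unfolding t_def by linarith
    also have "\<dots> = (91 + 2 * c) * (M * W)" by (simp add: algebra_simps)
    also have "M * W = M * k\<^sup>2 * (card (verts G))\<^sup>2" by (simp add: W_def U_def G' power_mult_distrib)
    finally show ?thesis .
  qed
  ultimately show thesis using that[OF run] by blast
qed

text \<open>Both halves are read off \<open>klone_result\<close> on the almost sure event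
  \<open>good_sample\<close>.\<close>

theorem mainTheorem3:
  shows
    "(\<forall>(G :: ('v, 'l) graph) \<Sigma> k Qs LA M p\<omega> (p :: dir \<Rightarrow> nat pmf) tU.
        klone_input G \<Sigma> k Qs LA M p\<omega> \<longrightarrow>
        (AE s in klone_space p\<omega> p. \<forall>ch. valid_choices G k LA ch \<longrightarrow>
           (\<exists>A t. klone G \<Sigma> k Qs LA M tU ch s = Some (A, t) \<and>
              (labels_suffice LA (verts A) \<longrightarrow>
                 (\<forall>x\<in>{1..card (verts G)}. chase_anonymisation k x G \<Sigma> A))))) \<and>
     (\<forall>c::nat. \<exists>K::nat. \<forall>(G :: ('v, 'l) graph) \<Sigma> k Qs LA M p\<omega> (p :: dir \<Rightarrow> nat pmf) tU.
        klone_input G \<Sigma> k Qs LA M p\<omega> \<and>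
        (\<forall>H A. tU H A \<le> c) \<and> (\<forall>d. set_pmf (p d) \<subseteq> {1..card (verts G)}) \<longrightarrow>
        (AE s in klone_space p\<omega> p. \<forall>ch. valid_choices G k LA ch \<longrightarrow>
           (\<exists>A t. klone G \<Sigma> k Qs LA M tU ch s = Some (A, t) \<and>
              t \<le> K * (M * k\<^sup>2 * (card (verts G))\<^sup>2))))"
proof (intro conjI allI impI)
  fix G :: "('v, 'l) graph" and \<Sigma> k Qs LA M p\<omega> and p :: "dir \<Rightarrow> nat pmf"
    and tU :: "('v, 'l) graph \<Rightarrow> ('v, 'l) graph \<Rightarrow> nat"
  assume input: "klone_input G \<Sigma> k Qs LA M p\<omega>"
  show "AE s in klone_space p\<omega> p. \<forall>ch. valid_choices G k LA ch \<longrightarrow>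
           (\<exists>A t. klone G \<Sigma> k Qs LA M tU ch s = Some (A, t) \<and>
              (labels_suffice LA (verts A) \<longrightarrow>
                 (\<forall>x\<in>{1..card (verts G)}. chase_anonymisation k x G \<Sigma> A)))"
    using AE_good_sample[OF input]
  proof (rule eventually_mono, intro allI impI)
    fix s ch assume "good_sample G M p s" "valid_choices G k LA ch"
    then show "\<exists>A t. klone G \<Sigma> k Qs LA M tU ch s = Some (A, t) \<and>
        (labels_suffice LA (verts A) \<longrightarrow> (\<forall>x\<in>{1..card (verts G)}. chase_anonymisation k x G \<Sigma> A))"
    proof (rule klone_result[OF input, of p s ch tU])
      fix A t assume "klone G \<Sigma> k Qs LA M tU ch s = Some (A, t)"
        and "labels_suffice LA (verts A) \<longrightarrow> (\<forall>x. chase_anonymisation k x G \<Sigma> A)"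
      then show ?thesis by (intro exI[of _ A] exI[of _ t] conjI) simp_all
    qed
  qed
next
  fix c :: nat
  show "\<exists>K::nat. \<forall>(G :: ('v, 'l) graph) \<Sigma> k Qs LA M p\<omega> (p :: dir \<Rightarrow> nat pmf) tU.
        klone_input G \<Sigma> k Qs LA M p\<omega> \<and>
        (\<forall>H A. tU H A \<le> c) \<and> (\<forall>d. set_pmf (p d) \<subseteq> {1..card (verts G)}) \<longrightarrow>
        (AE s in klone_space p\<omega> p. \<forall>ch. valid_choices G k LA ch \<longrightarrow>
           (\<exists>A t. klone G \<Sigma> k Qs LA M tU ch s = Some (A, t) \<and>
              t \<le> K * (M * k\<^sup>2 * (card (verts G))\<^sup>2)))"
  \<comment> \<open>The constant depends on nothing but the bound \<open>c\<close> on the cost of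
    one utility evaluation.\<close>
  proof (intro exI[of _ "91 + 2 * c"] allI impI, elim conjE)
    fix G :: "('v, 'l) graph" and \<Sigma> k Qs LA M p\<omega> and p :: "dir \<Rightarrow> nat pmf"
      and tU :: "('v, 'l) graph \<Rightarrow> ('v, 'l) graph \<Rightarrow> nat"
    assume input: "klone_input G \<Sigma> k Qs LA M p\<omega>" and tU: "\<forall>H A. tU H A \<le> c"
      and supp: "\<forall>d. set_pmf (p d) \<subseteq> {1..card (verts G)}"
    show "AE s in klone_space p\<omega> p. \<forall>ch. valid_choices G k LA ch \<longrightarrow>
           (\<exists>A t. klone G \<Sigma> k Qs LA M tU ch s = Some (A, t) \<and>
              t \<le> (91 + 2 * c) * (M * k\<^sup>2 * (card (verts G))\<^sup>2))"
      using AE_good_sample[OF input]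
    proof (rule eventually_mono, intro allI impI)
      fix s ch assume good: "good_sample G M p s" and valid: "valid_choices G k LA ch"
      \<comment> \<open>On the same event, the support condition becomes a bound on every degree
        draw.\<close>
      have z: "snd s q \<le> card (verts G)" for q
      proof -
        have "snd s q \<in> set_pmf (p (fst q))" using good unfolding good_sample_def by blast
        then have "snd s q \<in> {1..card (verts G)}" using supp[THEN spec] by (rule rev_subsetD)
        then show ?thesis by simp
      qed
      show "\<exists>A t. klone G \<Sigma> k Qs LA M tU ch s = Some (A, t) \<and>
          t \<le> (91 + 2 * c) * (M * k\<^sup>2 * (card (verts G))\<^sup>2)"
      proof (rule klone_result[OF input good valid, of tU])
        fix A t assume run: "klone G \<Sigma> k Qs LA M tU ch s = Some (A, t)"
          and time: "\<forall>c. (\<forall>H A. tU H A \<le> c) \<and> (\<forall>q. snd s q \<le> card (verts G)) \<longrightarrow>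
            t \<le> (91 + 2 * c) * (M * k\<^sup>2 * (card (verts G))\<^sup>2)"
        have "t \<le> (91 + 2 * c) * (M * k\<^sup>2 * (card (verts G))\<^sup>2)"
          by (rule time[THEN spec, THEN mp]) (intro conjI tU allI z)
        with run show ?thesis by (intro exI[of _ A] exI[of _ t] conjI)
      qed
    qed
  qed
qed

end
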